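(* Let $(X_1,d_1)$, $(X_2,d_2)$ be proper $\mathrm{CAT}(-1)$ spaces and let $\overline{X_1\times X_2}^{\max}$ be the horofunction compactification of $X_1\times X_2$ with respect to $d_{\max}$. Let $\Gamma$ be an infinite hyperbolic group and let $\rho_1\colon\Gamma\to\operatorname{Isom}(X_1)$, $\rho_2\colon\Gamma\to\operatorname{Isom}(X_2)$ be two quasi-convex representations. The following are equivalent: (a) $\Lambda_{\rho_1\times\rho_2}\subset\partial_\infty^{\max}(X_1\times X_2)_{\mathrm{reg}}$; (b) $\rho_1$ and $\rho_2$ are coarsely equivalent; (c) $\tau(\rho_1(\gamma))=\tau(\rho_2(\gamma))$ for all $\gamma\in\Gamma$.
   Context: Horofunction compactification: for a proper metric space $(Y,d)$ let $C_*(Y)$ be the space of continuous real functions on $Y$ (topology of uniform convergence on compact sets) modulo additive constants, and $\iota\colon Y\to C_*(Y)$, $\iota(y)=[d(y,\cdot)]$. The horofunction compactification is the closure of $\iota(Y)$ in $C_*(Y)$; the ideal boundary is the complement of $\iota(Y)$ in it; $Y$ is identified with $\iota(Y)$. $d_{\max}((x,y),(x',y'))=\max\{d_1(x,x'),d_2(y,y')\}$, and $\partial_\infty^{\max}(X_1\times X_2)$ denotes the ideal boundary of $\overline{X_1\times X_2}^{\max}$. For a proper $\mathrm{CAT}(-1)$ space $X$ with visual boundary $\partial_\infty X$, $o\in X$ and $\xi\in\partial_\infty X$, let $\beta^o_\xi(z)=\lim_{t\to+\infty}d(c(t),z)-t$, where $c$ is the geodesic ray from $o$ in the class $\xi$.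 Fix base points $o\in X_1$, $o'\in X_2$. The regular part $\partial_\infty^{\max}(X_1\times X_2)_{\mathrm{reg}}$ is the set of ideal points represented by functions $(z,z')\mapsto\max\{\beta^o_\xi(z),\beta^{o'}_{\xi'}(z')-C\}$ with $\xi\in\partial_\infty X_1$, $\xi'\in\partial_\infty X_2$, $C\in\mathbb R$ (the other ideal points, called singular, are represented by a Busemann function of one factor only). The product action is $\gamma(x,y)=(\rho_1(\gamma)x,\rho_2(\gamma)y)$. Its large limit set is $$\Lambda_{\rho_1\times\rho_2}=\bigcup_{(x,y)\in X_1\times X_2}\overline{\{(\rho_1(\gamma)x,\rho_2(\gamma)y):\gamma\in\Gamma\}}\cap\partial_\infty^{\max}(X_1\times X_2),$$ with closure taken in $\overline{X_1\times X_2}^{\max}$. A subset $S$ of a $\mathrm{CAT}(-1)$ space $X$ is quasi-convex if there is $\varepsilon\ge0$ such that the union of all geodesic segments with endpoints in $S$ is contained in the $\varepsilon$-neighborhood of $S$. A group of isometries of $X$ is quasi-convex if it acts properly discontinuously on $X$ (every compact set meets only finitely many of its translates) and every orbit is a quasi-convex set. A representation $\rho_i$ is quasi-convex if it has finite kernel and $\rho_i(\Gamma)$ is a discrete quasi-convex group. $\rho_1,\rho_2$ are coarsely equivalent if there exist $C>0$, $o\in X_1$ and $o'\in X_2$ such that $|d_1(\rho_1(\gamma)o,\rho_1(\gamma')o)-d_2(\rho_2(\gamma)o',\rho_2(\gamma')o')|\le C$ for all $\gamma,\gamma'\in\Gamma$. The translation length is $\tau(\rho_i(\gamma))=\lim_{n\to\infty}\frac{d_i(x,\rho_i(\gamma)^n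 x)}{n}$ for any $x\in X_i$. *)

theory Defs
  imports "HOL-Analysis.Analysis" "HOL-Algebra.Generated_Groups"
begin

section \<open>Geodesics and proper CAT(-1) spaces\<close>

text \<open>Geodesics are stated for an explicit carrier and distance function, because they are used both
  in metric spaces (with \<open>UNIV\<close> and \<open>dist\<close>) and in the hyperbolic plane. Only the values
  of \<open>c\<close> on \<open>[0, d x y]\<close> are relevant.\<close>

definition geodesic :: "'a set \<Rightarrow> ('a \<Rightarrow> 'a \<Rightarrow> real) \<Rightarrow> (real \<Rightarrow> 'a) \<Rightarrow> 'a \<Rightarrow> 'a \<Rightarrow> bool" where
  "geodesic M d c x y \<longleftrightarrow>
     c 0 = x \<and> c (d x y) = y \<and>
     (\<forall>t\<in>{0..d x y}. c t \<in> M) \<and>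
     (\<forall>s\<in>{0..d x y}. \<forall>t\<in>{0..d x y}. d (c s) (c t) = \<bar>s - t\<bar>)"

definition upper_half_plane :: "complex set" where
  "upper_half_plane = {z. Im z > 0}"

definition hyp_dist :: "complex \<Rightarrow> complex \<Rightarrow> real" where
  "hyp_dist z w = arcosh (1 + (cmod (z - w))\<^sup>2 / (2 * Im z * Im w))"

text \<open>The comparison inequality is stated for points on two sides issuing from a common vertex
  \<open>p\<close> of the triangle \<open>p, q, r\<close>. As \<open>p, q, r\<close> range over all points, this covers any two
  distinct sides of a geodesic triangle; for two points on one and the same side the inequality
  is an equality. The comparison points of \<open>a s\<close> and \<open>b t\<close> are \<open>a' s\<close> and \<open>b' t\<close>.\<close>

definition CAT_neg1 :: "'a::metric_space itself \<Rightarrow> bool" where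
  "CAT_neg1 (T :: 'a itself) \<longleftrightarrow>
     (\<forall>x y :: 'a. \<exists>c. geodesic UNIV dist c x y) \<and>
     (\<forall>(p :: 'a) q r a b p' q' r' a' b'.
        geodesic UNIV dist a p q \<longrightarrow> geodesic UNIV dist b p r \<longrightarrow>
        p' \<in> upper_half_plane \<longrightarrow> q' \<in> upper_half_plane \<longrightarrow> r' \<in> upper_half_plane \<longrightarrow>
        hyp_dist p' q' = dist p q \<longrightarrow> hyp_dist q' r' = dist q r \<longrightarrow> hyp_dist p' r' = dist p r \<longrightarrow>
        geodesic upper_half_plane hyp_dist a' p' q' \<longrightarrow>
        geodesic upper_half_plane hyp_dist b' p' r' \<longrightarrow>
        (\<forall>s\<in>{0..dist p q}. \<forall>t\<in>{0..dist p r}. dist (a s) (b t) \<le> hyp_dist (a' s) (b' t)))"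

definition proper_space :: "'a::metric_space itself \<Rightarrow> bool" where
  "proper_space (T :: 'a itself) \<longleftrightarrow> (\<forall>(x :: 'a) r. compact (cball x r))"


section \<open>Visual boundary and Busemann functions\<close>

text \<open>Rays are total functions on the reals of which only the restriction to \<open>[0, \<infinity>)\<close> matters.\<close>

definition geodesic_rays :: "(real \<Rightarrow> 'a::metric_space) set" where
  "geodesic_rays = {c. \<forall>s\<ge>0. \<forall>t\<ge>0. dist (c s) (c t) = \<bar>s - t\<bar>}"

definition asymptotic_rel :: "((real \<Rightarrow> 'a::metric_space) \<times> (real \<Rightarrow> 'a)) set" where
  "asymptotic_rel = {(c, c'). c \<in> geodesic_rays \<and> c' \<in> geodesic_rays \<and>
                              (\<exists>B. \<forall>t\<ge>0. dist (c t) (c' t) \<le> B)}"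

definition visual_boundary :: "(real \<Rightarrow> 'a::metric_space) set set" where
  "visual_boundary = geodesic_rays // asymptotic_rel"

definition busemann :: "'a::metric_space \<Rightarrow> (real \<Rightarrow> 'a) set \<Rightarrow> 'a \<Rightarrow> real" where
  "busemann p \<xi> z =
     (let c = (SOME c. c \<in> \<xi> \<and> c 0 = p) in Lim at_top (\<lambda>t. dist (c t) z - t))"


section \<open>Horofunction compactification\<close>

text \<open>The distance \<open>d\<close> is a parameter (rather than the type class \<open>dist\<close>) because products are
  equipped with the maximum distance and not with the library's Euclidean product distance.\<close>

definition cont_funs :: "('y \<Rightarrow> 'y \<Rightarrow> real) \<Rightarrow> ('y \<Rightarrow> real) set" where
  "cont_funs d = {f. continuous_map (Metric_space.mtopology UNIV d) euclideanreal f}"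

definition ucc_topology :: "('y \<Rightarrow> 'y \<Rightarrow> real) \<Rightarrow> ('y \<Rightarrow> real) topology" where
  "ucc_topology d = topology_generated_by
     {{f \<in> cont_funs d. \<forall>y\<in>K. \<bar>f y - g y\<bar> < \<epsilon>} | g K \<epsilon>.
        g \<in> cont_funs d \<and> compactin (Metric_space.mtopology UNIV d) K \<and> \<epsilon> > 0}"

definition mod_const :: "('y \<Rightarrow> real) \<Rightarrow> ('y \<Rightarrow> real) set" where
  "mod_const f = {g. \<exists>c. \<forall>y. g y = f y + c}"

text \<open>Quotient topology on continuous functions modulo additive constants.\<close>

definition Cstar :: "('y \<Rightarrow> 'y \<Rightarrow> real) \<Rightarrow> ('y \<Rightarrow> real) set topology" where
  "Cstar d = topology (\<lambda>U. U \<subseteq> mod_const ` cont_funs d \<and>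
                           openin (ucc_topology d) {f \<in> cont_funs d. mod_const f \<in> U})"

definition horo_embed :: "('y \<Rightarrow> 'y \<Rightarrow> real) \<Rightarrow> 'y \<Rightarrow> ('y \<Rightarrow> real) set" where
  "horo_embed d y = mod_const (d y)"

definition horo_compactification :: "('y \<Rightarrow> 'y \<Rightarrow> real) \<Rightarrow> ('y \<Rightarrow> real) set topology" where
  "horo_compactification d = subtopology (Cstar d) (Cstar d closure_of range (horo_embed d))"

definition ideal_boundary :: "('y \<Rightarrow> 'y \<Rightarrow> real) \<Rightarrow> ('y \<Rightarrow> real) set set" where
  "ideal_boundary d = topspace (horo_compactification d) - range (horo_embed d)"

lemma topspace_ucc_topology: "topspace (ucc_topology d) = cont_funs d"
proof -
  have "cont_funs d \<subseteq> topspace (ucc_topology d)"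
  proof
    fix f assume f: "f \<in> cont_funs d"
    have "f \<in> {h \<in> cont_funs d. \<forall>y\<in>{}. \<bar>h y - f y\<bar> < (1::real)}"
      using f by simp
    moreover have "compactin (Metric_space.mtopology UNIV d) {}"
      by simp
    ultimately show "f \<in> topspace (ucc_topology d)"
      unfolding ucc_topology_def topology_generated_by_topspace
      using f by (intro UnionI[where X = "{h \<in> cont_funs d. \<forall>y\<in>{}. \<bar>h y - f y\<bar> < (1::real)}"])
        (auto intro!: exI[of _ "{}"] exI[of _ f] exI[of _ "1::real"])
  qed
  moreover have "topspace (ucc_topology d) \<subseteq> cont_funs d"
    unfolding ucc_topology_def topology_generated_by_topspace by auto
  ultimately show ?thesis by blast
qed

lemma openin_Cstar:
  "openin (Cstar d) U \<longleftrightarrow>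
     U \<subseteq> mod_const ` cont_funs d \<and> openin (ucc_topology d) {f \<in> cont_funs d. mod_const f \<in> U}"
proof -
  have Int: "{f \<in> cont_funs d. mod_const f \<in> S \<inter> T} =
        {f \<in> cont_funs d. mod_const f \<in> S} \<inter> {f \<in> cont_funs d. mod_const f \<in> T}" for S T
    by auto
  have Un: "{f \<in> cont_funs d. mod_const f \<in> \<Union>\<K>} =
        \<Union> ((\<lambda>S. {f \<in> cont_funs d. mod_const f \<in> S}) ` \<K>)" for \<K>
    by auto
  have "istopology (\<lambda>U. U \<subseteq> mod_const ` cont_funs d \<and>
                        openin (ucc_topology d) {f \<in> cont_funs d. mod_const f \<in> U})"
    unfolding istopology_def Int Un by (blast intro: openin_Int openin_Union)
  then show ?thesis
    by (simp add: Cstar_def)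
qed

lemma topspace_Cstar: "topspace (Cstar d) = mod_const ` cont_funs d"
proof
  show "topspace (Cstar d) \<subseteq> mod_const ` cont_funs d"
    using openin_Cstar[of d "topspace (Cstar d)"] by simp
  have "{f \<in> cont_funs d. mod_const f \<in> mod_const ` cont_funs d} = topspace (ucc_topology d)"
    unfolding topspace_ucc_topology by auto
  then have "openin (Cstar d) (mod_const ` cont_funs d)"
    unfolding openin_Cstar by (metis openin_topspace order_refl)
  then show "mod_const ` cont_funs d \<subseteq> topspace (Cstar d)"
    by (rule openin_subset)
qed


section \<open>The product with the maximum distance\<close>

definition dmax :: "'a::metric_space \<times> 'b::metric_space \<Rightarrow> 'a \<times> 'b \<Rightarrow> real" where
  "dmax p q = max (dist (fst p) (fst q)) (dist (snd p) (snd q))"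

lemma Metric_space_dmax: "Metric_space UNIV dmax"
proof
  show "dmax x z \<le> dmax x y + dmax y z" for x y z :: "'a \<times> 'b"
    using dist_triangle[of "fst x" "fst z" "fst y"] dist_triangle[of "snd x" "snd z" "snd y"]
    unfolding dmax_def by linarith
qed (auto simp: dmax_def dist_commute prod_eq_iff max_def)

definition ideal_boundary_reg ::
    "'a::metric_space \<Rightarrow> 'b::metric_space \<Rightarrow> ('a \<times> 'b \<Rightarrow> real) set set" where
  "ideal_boundary_reg p p' =
     {\<eta> \<in> ideal_boundary dmax.
        \<exists>\<xi>\<in>visual_boundary. \<exists>\<xi>'\<in>visual_boundary. \<exists>C::real.
          \<eta> = mod_const (\<lambda>(z, z'). max (busemann p \<xi> z) (busemann p' \<xi>' z' - C))}"


section \<open>Isometries and quasi-convex representations\<close>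

definition isometry_group :: "('a::metric_space \<Rightarrow> 'a) monoid" where
  "isometry_group = \<lparr>carrier = {f. surj f \<and> (\<forall>x y. dist (f x) (f y) = dist x y)},
                     mult = (\<circ>), one = id\<rparr>"

lemma group_isometry_group: "group (isometry_group :: ('a::metric_space \<Rightarrow> 'a) monoid)"
proof (rule groupI)
  fix f :: "'a \<Rightarrow> 'a" assume "f \<in> carrier isometry_group"
  then have surj: "surj f" and iso: "\<And>x y. dist (f x) (f y) = dist x y"
    by (auto simp: isometry_group_def)
  have "inj f"
    by (rule injI) (metis dist_eq_0_iff iso)
  then have "surj (inv_into UNIV f)"
    by (rule inj_imp_surj_inv)
  moreover have "dist (inv_into UNIV f x) (inv_into UNIV f y) = dist x y" for x y
    by (metis iso surj surj_f_inv_f)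
  ultimately show "\<exists>g\<in>carrier isometry_group. g \<otimes>\<^bsub>isometry_group\<^esub> f = \<one>\<^bsub>isometry_group\<^esub>"
    using \<open>inj f\<close> by (intro bexI[of _ "inv_into UNIV f"]) (auto simp: isometry_group_def)
qed (auto simp: isometry_group_def o_assoc surj_def, metis?)

definition properly_discontinuous :: "('a::metric_space \<Rightarrow> 'a) set \<Rightarrow> bool" where
  "properly_discontinuous H \<longleftrightarrow> (\<forall>K. compact K \<longrightarrow> finite {h \<in> H. h ` K \<inter> K \<noteq> {}})"

text \<open>Discreteness as a subset of the isometry group, with uniform convergence on compact sets.\<close>

definition discrete_isometries :: "('a::metric_space \<Rightarrow> 'a) set \<Rightarrow> bool" where
  "discrete_isometries H \<longleftrightarrow>
     (\<forall>g\<in>H. \<exists>K \<epsilon>. compact K \<and> \<epsilon> > 0 \<and> (\<forall>h\<in>H. (\<forall>x\<in>K. dist (h x) (g x) < \<epsilon>) \<longrightarrow> h = g))"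

definition quasi_convex_set :: "'a::metric_space set \<Rightarrow> bool" where
  "quasi_convex_set S \<longleftrightarrow>
     (\<exists>\<epsilon>\<ge>0. \<forall>x\<in>S. \<forall>y\<in>S. \<forall>c. geodesic UNIV dist c x y \<longrightarrow>
        (\<forall>t\<in>{0..dist x y}. \<exists>z\<in>S. dist (c t) z \<le> \<epsilon>))"

definition quasi_convex_group :: "('a::metric_space \<Rightarrow> 'a) set \<Rightarrow> bool" where
  "quasi_convex_group H \<longleftrightarrow>
     properly_discontinuous H \<and> (\<forall>x. quasi_convex_set ((\<lambda>h. h x) ` H))"

definition quasi_convex_rep ::
    "('g, 'm) monoid_scheme \<Rightarrow> ('g \<Rightarrow> 'a::metric_space \<Rightarrow> 'a) \<Rightarrow> bool" where
  "quasi_convex_rep G \<rho> \<longleftrightarrow>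
     \<rho> \<in> hom G isometry_group \<and> finite (kernel G isometry_group \<rho>) \<and>
     discrete_isometries (\<rho> ` carrier G) \<and> quasi_convex_group (\<rho> ` carrier G)"

definition coarsely_equivalent ::
    "('g, 'm) monoid_scheme \<Rightarrow> ('g \<Rightarrow> 'a::metric_space \<Rightarrow> 'a) \<Rightarrow> ('g \<Rightarrow> 'b::metric_space \<Rightarrow> 'b) \<Rightarrow> bool"
  where
  "coarsely_equivalent G \<rho>1 \<rho>2 \<longleftrightarrow>
     (\<exists>C>0. \<exists>p p'. \<forall>g\<in>carrier G. \<forall>h\<in>carrier G.
        \<bar>dist (\<rho>1 g p) (\<rho>1 h p) - dist (\<rho>2 g p') (\<rho>2 h p')\<bar> \<le> C)"

definition translation_length :: "('a::metric_space \<Rightarrow> 'a) \<Rightarrow> real" where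
  "translation_length f =
     (THE l. \<forall>x. (\<lambda>n. dist x ((f ^^ n) x) / real n) \<longlonglongrightarrow> l)"

definition large_limit_set ::
    "('g, 'm) monoid_scheme \<Rightarrow> ('g \<Rightarrow> 'a::metric_space \<Rightarrow> 'a) \<Rightarrow> ('g \<Rightarrow> 'b::metric_space \<Rightarrow> 'b) \<Rightarrow>
     ('a \<times> 'b \<Rightarrow> real) set set" where
  "large_limit_set G \<rho>1 \<rho>2 =
     (\<Union>(x, y)\<in>UNIV.
        (horo_compactification dmax closure_of
           {horo_embed dmax (\<rho>1 g x, \<rho>2 g y) | g. g \<in> carrier G}) \<inter> ideal_boundary dmax)"


section \<open>Hyperbolic groups\<close>

definition word_length :: "('g, 'm) monoid_scheme \<Rightarrow> 'g set \<Rightarrow> 'g \<Rightarrow> nat" where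
  "word_length G S g =
     (LEAST n. \<exists>w. length w = n \<and> set w \<subseteq> S \<union> m_inv G ` S \<and> foldr (mult G) w \<one>\<^bsub>G\<^esub> = g)"

definition word_dist :: "('g, 'm) monoid_scheme \<Rightarrow> 'g set \<Rightarrow> 'g \<Rightarrow> 'g \<Rightarrow> real" where
  "word_dist G S g h = real (word_length G S (inv\<^bsub>G\<^esub> g \<otimes>\<^bsub>G\<^esub> h))"

definition gromov_product :: "('a \<Rightarrow> 'a \<Rightarrow> real) \<Rightarrow> 'a \<Rightarrow> 'a \<Rightarrow> 'a \<Rightarrow> real" where
  "gromov_product d w x y = (d x w + d y w - d x y) / 2"

definition gromov_hyperbolic :: "'a set \<Rightarrow> ('a \<Rightarrow> 'a \<Rightarrow> real) \<Rightarrow> bool" where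
  "gromov_hyperbolic M d \<longleftrightarrow>
     (\<exists>\<delta>\<ge>0. \<forall>w\<in>M. \<forall>x\<in>M. \<forall>y\<in>M. \<forall>z\<in>M.
        gromov_product d w x z \<ge> min (gromov_product d w x y) (gromov_product d w y z) - \<delta>)"

definition hyperbolic_group :: "('g, 'm) monoid_scheme \<Rightarrow> bool" where
  "hyperbolic_group G \<longleftrightarrow> group G \<and>
     (\<exists>S. finite S \<and> S \<subseteq> carrier G \<and> generate G S = carrier G \<and>
          gromov_hyperbolic (carrier G) (word_dist G S))"

end

theory Submission
  imports Defs "HOL-Library.Diagonal_Subsequence"
begin

text \<open>Comparison with the hyperbolic plane gives Stewart's inequality for \<open>cosh\<close> of the distance. It
  yields Gromov's four-point condition and the convergence of \<open>d(x\<^sub>n, z) - d(x\<^sub>n, p)\<close>, along a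
  subsequence, to a Busemann function whenever \<open>x\<^sub>n\<close> tends to infinity.

  The horofunction limits of \<open>(\<rho>\<^sub>1(g\<^sub>n) p, \<rho>\<^sub>2(g\<^sub>n) p')\<close> are regular if the two displacements of
  \<open>g\<^sub>n\<close> differ by a bounded amount, and involve only one factor if the difference tends to infinity;
  hence (a) is equivalent to (b).

  Coarse equivalence forces equal translation lengths. Conversely, in each factor there is a finite
  set \<open>F\<close> of group elements such that every \<open>g\<close> has some \<open>f\<close> in \<open>F\<close> for which the translation length
  of \<open>g f\<close> agrees up to a constant with the displacement of \<open>g\<close>. As translation length never exceeds
  displacement, equality of translation lengths bounds each displacement by the other one. No
  comparison of the two boundaries, and hence no stability of quasi-geodesics, is needed.\<close>


section \<open>Stewart's inequality\<close>

text \<open>The obstacle is that translation length can be much smaller than displacement. Up to a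
  constant it is at least the displacement of \<open>g\<close> minus twice the Gromov product, seen
  from the base point, of the images of this point under \<open>g\<close> and its inverse, and that
  product is large for long conjugates of a short element. The factor \<open>f\<close> is there to
  bound it. Each action has its own set \<open>F\<close>: if translation lengths agree, the
  translation length of \<open>g f\<close> in one action is at most the displacement of
  \<open>g f\<close> in the other, and subadditivity removes \<open>f\<close> at a bounded cost, so
  the two sets never have to be compared.

  A common way to find \<open>f\<close> is to move the end of \<open>g\<close> away from a boundary
  point by two independent hyperbolic elements. Two-ended groups have no such pair, so the existence
  of \<open>F\<close> is proved by contradiction, from one hyperbolic element and the finiteness of
  balls. Curvature enters this group-theoretic part only through the four-point condition.\<close>

lemma cosh_hyp_dist:
  assumes "Im z > 0" "Im w > 0"
  shows "cosh (hyp_dist z w) = 1 + (cmod (z - w))\<^sup>2 / (2 * Im z * Im w)"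
  using assms by (simp add: hyp_dist_def cosh_arcosh_real)

lemma hyp_dist_vertical: "hyp_dist (\<i> * of_real (exp s)) (\<i> * of_real (exp t)) = \<bar>s - t\<bar>"
proof -
  have "\<i> * of_real (exp s) - \<i> * of_real (exp t) = \<i> * of_real (exp s - exp t)"
    by (simp add: algebra_simps)
  then have n: "(cmod (\<i> * of_real (exp s) - \<i> * of_real (exp t)))\<^sup>2 = (exp s - exp t)\<^sup>2"
    by (simp only: norm_mult norm_ii norm_of_real power_mult_distrib) simp
  have "1 + (exp s - exp t)\<^sup>2 / (2 * exp s * exp t) = cosh (s - t)"
    by (simp add: cosh_def exp_diff exp_minus field_simps power2_eq_square)
  then have "hyp_dist (\<i> * of_real (exp s)) (\<i> * of_real (exp t)) = arcosh (cosh (s - t))"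
    unfolding hyp_dist_def n by simp
  also have "\<dots> = arcosh (cosh \<bar>s - t\<bar>)"
    by simp
  finally show ?thesis
    by (simp only: arcosh_cosh_real abs_ge_zero)
qed

text \<open>For \<open>a\<^sup>2 + b\<^sup>2 = 1\<close> this is the hyperbolic rotation about \<i>
  given by the matrix with rows (a, b) and (-b, a). It turns the vertical geodesic into a second one
  through \<i>, at any prescribed angle.\<close>

definition moebius :: "real \<Rightarrow> real \<Rightarrow> complex \<Rightarrow> complex" where
  "moebius a b z = (of_real a * z + of_real b) / (of_real a - of_real b * z)"

lemma moebius_denominator:
  assumes "a\<^sup>2 + b\<^sup>2 = 1" "Im z > 0"
  shows "of_real a - of_real b * z \<noteq> (0 :: complex)"
proof
  assume "of_real a - of_real b * z = (0 :: complex)"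
  then have "Im (of_real a - of_real b * z) = 0" "Re (of_real a - of_real b * z) = 0"
    by simp_all
  then have "b = 0" "a = 0" using assms by auto
  then show False using assms by simp
qed

lemma Im_moebius:
  assumes "a\<^sup>2 + b\<^sup>2 = 1" "Im z > 0"
  shows "Im (moebius a b z) = Im z / (cmod (of_real a - of_real b * z))\<^sup>2"
proof -
  have "a * a * Im z + b * b * Im z = Im z"
    using assms by (metis distrib_right mult_1 power2_eq_square)
  then show ?thesis
    by (simp add: moebius_def Im_divide cmod_power2 algebra_simps)
qed

lemma Im_moebius_pos: "a\<^sup>2 + b\<^sup>2 = 1 \<Longrightarrow> Im z > 0 \<Longrightarrow> Im (moebius a b z) > 0"
  using moebius_denominator[of a b z] by (simp add: Im_moebius)

lemma moebius_diff:
  assumes "a\<^sup>2 + b\<^sup>2 = 1" "Im z > 0" "Im w > 0"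
  shows "moebius a b z - moebius a b w
       = (z - w) / ((of_real a - of_real b * z) * (of_real a - of_real b * w))"
proof -
  have 1: "complex_of_real a * complex_of_real a + complex_of_real b * complex_of_real b = 1"
    using assms(1) by (metis of_real_1 of_real_add of_real_mult power2_eq_square)
  have "(of_real a * z + of_real b) * (of_real a - of_real b * w) -
        (of_real a * w + of_real b) * (of_real a - of_real b * z)
     = (complex_of_real a * complex_of_real a + complex_of_real b * complex_of_real b) * (z - w)"
    by (simp add: algebra_simps)
  then show ?thesis
    using moebius_denominator[OF assms(1,2)] moebius_denominator[OF assms(1,3)] 1
    by (simp add: moebius_def diff_frac_eq)
qed

lemma hyp_dist_moebius:
  assumes "a\<^sup>2 + b\<^sup>2 = 1" "Im z > 0" "Im w > 0"
  shows "hyp_dist (moebius a b z) (moebius a b w) = hyp_dist z w"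
proof -
  have "cmod (of_real a - of_real b * z) \<noteq> 0" "cmod (of_real a - of_real b * w) \<noteq> 0"
    using moebius_denominator assms by auto
  moreover have "1 + (x / (u * v))\<^sup>2 / (2 * (y / u\<^sup>2) * (y' / v\<^sup>2)) = 1 + x\<^sup>2 / (2 * y * y')"
    if "u \<noteq> 0" "v \<noteq> 0" for u v x y y' :: real
    using that by (simp add: field_simps power_mult_distrib)
  ultimately show ?thesis
    using assms by (simp only: hyp_dist_def moebius_diff Im_moebius norm_divide norm_mult
        not_False_eq_True)
qed

text \<open>With \<open>a\<close> and \<open>b\<close> the cosine and sine of half the angle at
  \<i>, this is the hyperbolic law of cosines. Written as a convex combination of its values at the
  angles 0 and pi, it allows the angle to be found by linear interpolation.\<close>

lemma cosh_hyp_dist_moebius: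
  assumes "a\<^sup>2 + b\<^sup>2 = 1"
  shows "cosh (hyp_dist (\<i> * of_real (exp s)) (moebius a b (\<i> * of_real (exp m))))
       = a\<^sup>2 * cosh (m - s) + b\<^sup>2 * cosh (m + s)"
proof -
  define D where "D = a\<^sup>2 + b\<^sup>2 * (exp m)\<^sup>2"
  define w where "w = moebius a b (\<i> * of_real (exp m))"
  have nz: "of_real a - of_real b * (\<i> * of_real (exp m)) \<noteq> (0::complex)"
    by (rule moebius_denominator[OF assms]) simp
  have D: "(cmod (of_real a - of_real b * (\<i> * of_real (exp m))))\<^sup>2 = D"
    by (simp add: cmod_power2 D_def power_mult_distrib)
  have Dpos: "D > 0" using nz D by (metis zero_less_power2 norm_eq_zero)
  have Imw: "Im w = exp m / D"
    unfolding w_def using Im_moebius[OF assms, of "\<i> * of_real (exp m)"] D by simp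
  have cw: "(cmod w)\<^sup>2 = (a\<^sup>2 * (exp m)\<^sup>2 + b\<^sup>2) / D"
    unfolding w_def moebius_def norm_divide power_divide D
    by (simp add: cmod_power2 power_mult_distrib)
  have "(cmod (\<i> * of_real (exp s) - w))\<^sup>2 = (cmod w)\<^sup>2 + (exp s)\<^sup>2 - 2 * exp s * Im w"
    by (simp add: cmod_power2 power2_diff)
  then have "cosh (hyp_dist (\<i> * of_real (exp s)) w)
      = 1 + ((cmod w)\<^sup>2 + (exp s)\<^sup>2 - 2 * exp s * Im w) / (2 * exp s * Im w)"
    using Imw Dpos by (subst cosh_hyp_dist) auto
  also have "\<dots> = ((cmod w)\<^sup>2 + (exp s)\<^sup>2) / (2 * exp s * Im w)"
  proof -
    have "Im w > 0" using Imw Dpos by simp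
    then show ?thesis by (simp add: divide_simps)
  qed
  also have "\<dots> = (a\<^sup>2 * (exp m)\<^sup>2 + b\<^sup>2 + (exp s)\<^sup>2 * D) / (2 * exp s * exp m)"
    unfolding cw Imw using Dpos by (simp add: field_simps)
  also have "\<dots> = a\<^sup>2 * cosh (m - s) + b\<^sup>2 * cosh (m + s)"
    unfolding D_def
    by (simp add: cosh_def exp_diff exp_minus exp_add power2_eq_square field_simps)
  finally show ?thesis unfolding w_def .
qed

lemma cosh_interpolation:
  fixes m s L :: real
  shows "cosh (m + s) * sinh L = cosh m * sinh (L - s) + cosh (m + L) * sinh s"
  by (simp add: cosh_def sinh_def exp_diff exp_minus exp_add field_simps)

lemma convex_combination_between:
  fixes u v x :: real
  assumes "u \<le> x" "x \<le> v"
  obtains \<kappa> where "0 \<le> \<kappa>" "\<kappa> \<le> 1" "\<kappa> * u + (1 - \<kappa>) * v = x"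
proof (cases "u = v")
  case True then show ?thesis using assms that[of 0] by simp
next
  case False
  have "(v - x) / (v - u) * u + (1 - (v - x) / (v - u)) * v = v - (v - x) / (v - u) * (v - u)"
    by (simp only: algebra_simps)
  also have "\<dots> = x" using False by simp
  finally show ?thesis using assms False by (intro that[of "(v - x) / (v - u)"]) auto
qed

lemma geodesicD:
  assumes "geodesic UNIV dist c x y"
  shows "c 0 = x" "c (dist x y) = y"
    "\<lbrakk>0 \<le> s; s \<le> dist x y; 0 \<le> t; t \<le> dist x y\<rbrakk> \<Longrightarrow> dist (c s) (c t) = \<bar>s - t\<bar>"
    "\<lbrakk>0 \<le> t; t \<le> dist x y\<rbrakk> \<Longrightarrow> dist x (c t) = t"
    "\<lbrakk>0 \<le> t; t \<le> dist x y\<rbrakk> \<Longrightarrow> dist (c t) y = dist x y - t"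
proof -
  show *: "c 0 = x" "c (dist x y) = y"
    "\<lbrakk>0 \<le> s; s \<le> dist x y; 0 \<le> t; t \<le> dist x y\<rbrakk> \<Longrightarrow> dist (c s) (c t) = \<bar>s - t\<bar>" for s t
    using assms by (auto simp: geodesic_def)
  show "\<lbrakk>0 \<le> t; t \<le> dist x y\<rbrakk> \<Longrightarrow> dist x (c t) = t"
    using *(1) *(3)[of 0 t] by simp
  show "\<lbrakk>0 \<le> t; t \<le> dist x y\<rbrakk> \<Longrightarrow> dist (c t) y = dist x y - t"
    using *(2) *(3)[of t "dist x y"] by simp
qed

text \<open>For a triangle in the hyperbolic plane this is an equality (Stewart's theorem), because
  \<open>cosh\<close> of the distance to a fixed point is a combination of \<open>exp t\<close> and \<open>exp (-t)\<close> along a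
  unit speed geodesic.\<close>

lemma CAT_neg1_stewart:
  fixes p q z :: "'a::metric_space"
  assumes CAT: "CAT_neg1 TYPE('a)" and c: "geodesic UNIV dist c p q"
    and t: "0 \<le> t" "t \<le> dist p q"
  shows "cosh (dist z (c t)) * sinh (dist p q)
       \<le> sinh (dist p q - t) * cosh (dist z p) + sinh t * cosh (dist z q)"
proof -
  define L m D where "L = dist p q" and "m = dist p z" and "D = dist q z"
  have "\<bar>m - L\<bar> \<le> D" "D \<le> m + L"
    unfolding L_def m_def D_def
    using dist_triangle[of p z q] dist_triangle[of p q z] dist_triangle[of q z p]
    by (auto simp: dist_commute)
  moreover have "cosh (m - L) = cosh \<bar>m - L\<bar>" by simp
  ultimately have D: "cosh (m - L) \<le> cosh D" "cosh D \<le> cosh (m + L)"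
    by (metis abs_ge_zero cosh_real_nonneg_le_iff order_trans,
        metis D_def cosh_real_nonneg_le_iff order_trans zero_le_dist)
  \<comment> \<open>\<open>\<kappa>\<close> is the squared cosine of half the comparison angle at
    \<open>p\<close>.\<close>
  obtain \<kappa> where \<kappa>: "0 \<le> \<kappa>" "\<kappa> \<le> 1" "\<kappa> * cosh (m - L) + (1 - \<kappa>) * cosh (m + L) = cosh D"
    using convex_combination_between[OF D] by metis
  define a b where "a = sqrt \<kappa>" and "b = sqrt (1 - \<kappa>)"
  have ab: "a\<^sup>2 + b\<^sup>2 = 1" and a2: "a\<^sup>2 = \<kappa>" and b2: "b\<^sup>2 = 1 - \<kappa>"
    using \<kappa> by (auto simp: a_def b_def)
  define V where "V = (\<lambda>s. \<i> * complex_of_real (exp s))"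
  define W where "W = (\<lambda>s. moebius a b (V s))"
  have ImV: "Im (V s) > 0" for s by (simp add: V_def)
  have ImW: "Im (W s) > 0" for s unfolding W_def by (rule Im_moebius_pos[OF ab ImV])
  have VV: "hyp_dist (V s) (V u) = \<bar>s - u\<bar>" for s u
    unfolding V_def by (rule hyp_dist_vertical)
  have WW: "hyp_dist (W s) (W u) = \<bar>s - u\<bar>" for s u
    unfolding W_def by (simp add: hyp_dist_moebius[OF ab ImV ImV] VV)
  have VW: "cosh (hyp_dist (V s) (W u)) = \<kappa> * cosh (u - s) + (1 - \<kappa>) * cosh (u + s)" for s u
    unfolding W_def V_def cosh_hyp_dist_moebius[OF ab] a2 b2 ..
  have nn: "hyp_dist x y \<ge> 0" if "Im x > 0" "Im y > 0" for x y
    using that unfolding hyp_dist_def by simp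
  have inj: "x = y" if "x \<ge> 0" "y \<ge> 0" "cosh x = cosh y" for x y :: real
    using that by (metis cosh_real_nonneg_le_iff order_antisym order_refl)
  have V0: "V 0 = W 0"
  proof -
    have "cosh (hyp_dist (V 0) (W 0)) = 1" unfolding VW by simp
    then have "1 + (cmod (V 0 - W 0))\<^sup>2 / (2 * Im (V 0) * Im (W 0)) = 1"
      using cosh_hyp_dist[OF ImV ImW] by metis
    then show ?thesis using ImV[of 0] ImW[of 0] by auto
  qed
  have qr: "hyp_dist (V L) (W m) = D"
    by (rule inj) (use nn ImV ImW VW \<kappa> in \<open>auto simp: D_def\<close>)
  \<comment> \<open>The CAT(-1) inequality compares points on two sides issuing from
    \<open>p\<close>. The side \<open>b0\<close> is used only at its far end, where
    \<open>b0 m = z\<close>.\<close>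
  obtain b0 where b0: "geodesic UNIV dist b0 p z"
    using CAT unfolding CAT_neg1_def by blast
  have "geodesic upper_half_plane hyp_dist V (V 0) (V L)"
    "geodesic upper_half_plane hyp_dist W (V 0) (W m)"
    unfolding V0 geodesic_def
    unfolding V0[symmetric] by (auto simp: VV WW V0 ImV ImW upper_half_plane_def L_def m_def)
       (auto simp: V0[symmetric] VV)
  then have "dist (c t) (b0 m) \<le> hyp_dist (V t) (W m)"
    using CAT[unfolded CAT_neg1_def, THEN conjunct2, rule_format, OF c b0, of "V 0" "V L" "W m" V W t m]
      t qr VV[of 0 L] WW[of 0 m] V0 ImV ImW
    by (simp add: upper_half_plane_def L_def m_def D_def)
  then have "cosh (dist z (c t)) \<le> cosh (hyp_dist (V t) (W m))"
    using geodesicD(2)[OF b0] nn[OF ImV ImW]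
    by (intro cosh_real_nonneg_le_iff[THEN iffD2]) (auto simp: m_def dist_commute)
  then have "cosh (dist z (c t)) * sinh L \<le> (\<kappa> * cosh (m - t) + (1 - \<kappa>) * cosh (m + t)) * sinh L"
    unfolding VW by (intro mult_right_mono) (auto simp: L_def)
  also have "\<dots> = \<kappa> * (cosh (-m + t) * sinh L) + (1 - \<kappa>) * (cosh (m + t) * sinh L)"
    using cosh_minus[of "m - t"] by (simp add: algebra_simps)
  also have "\<dots> = sinh (L - t) * cosh m
      + sinh t * (\<kappa> * cosh (m - L) + (1 - \<kappa>) * cosh (m + L))"
    unfolding cosh_interpolation[of _ t L] using cosh_minus[of "m - L"] by (simp add: algebra_simps)
  finally show ?thesis
    unfolding \<kappa> by (simp add: L_def m_def D_def dist_commute)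
qed


section \<open>The four-point condition\<close>

lemma cosh_le_exp: "0 \<le> x \<Longrightarrow> cosh x \<le> exp (x::real)"
  by (simp add: cosh_def)

lemma exp_le_2_cosh: "exp (x::real) \<le> 2 * cosh x"
  by (simp add: cosh_def)

lemma cosh_add_le:
  fixes t h :: real
  assumes "0 \<le> t" "0 \<le> h"
  shows "cosh (t + h) \<le> exp h * cosh t"
proof -
  have "exp (- t - h) \<le> exp (h - t)" using assms by simp
  then show ?thesis
    by (simp add: cosh_def exp_add[symmetric] algebra_simps)
qed

lemma sinh_diff_le:
  fixes L t :: real
  assumes "0 \<le> t" "t \<le> L"
  shows "sinh (L - t) \<le> exp (- t) * sinh L"
proof -
  have "exp (- (L + t)) \<le> exp (t - L)" using assms by simp
  then show ?thesis by (simp add: sinh_def exp_add[symmetric] algebra_simps)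
qed

lemma sinh_cosh_split: "sinh (L - t) * cosh t + sinh t * cosh (L - t) = sinh (L::real)"
  using sinh_add[of "L - t" t] by simp

text \<open>The bound on \<open>t\<close> says that \<open>c t\<close> lies between \<open>x\<close> and, up to a bounded error, the
  projection of \<open>y\<close> to the side from \<open>x\<close> to \<open>z\<close>.\<close>

lemma CAT_neg1_near_side:
  fixes x y z :: "'a::metric_space"
  assumes CAT: "CAT_neg1 TYPE('a)" and c: "geodesic UNIV dist c x z"
    and t: "0 \<le> t" "t \<le> gromov_product dist x y z"
  shows "gromov_product dist (c t) x y \<le> ln 2"
proof (cases "x = z")
  case True
  then have "t = 0" using t by (simp add: gromov_product_def dist_commute)
  then show ?thesis using geodesicD(1)[OF c] by (simp add: gromov_product_def dist_commute)
next
  case False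
  define L where "L = dist x z"
  \<comment> \<open>\<open>t0\<close>, \<open>h\<close> and \<open>L - t0\<close> are the legs of
    the comparison tripod at \<open>x\<close>, \<open>y\<close> and \<open>z\<close>.\<close>
  define t0 where "t0 = gromov_product dist x y z"
  define h where "h = dist x y - t0"
  have L: "L > 0" using False by (simp add: L_def)
  have tri: "dist x y \<le> L + dist y z" "dist y z \<le> dist x y + L" "L \<le> dist x y + dist y z"
    unfolding L_def using dist_triangle[of x y z] dist_triangle[of y z x] dist_triangle[of x z y]
    by (auto simp: dist_commute)
  have t0: "t0 = (dist x y + L - dist y z) / 2"
    by (simp add: t0_def L_def gromov_product_def dist_commute)
  have h0: "h \<ge> 0" "t0 \<le> L" "0 \<le> t0" using tri by (simp_all add: h_def t0 field_simps)
  have tt: "t \<le> t0" "t \<le> L" using t h0 by (auto simp: t0_def)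
  have dyx: "dist y x = t0 + h" by (simp add: h_def dist_commute)
  have dyz: "dist y z = (L - t0) + h" by (simp add: h_def t0 field_simps)
  have a: "sinh (L - t) * cosh (t0 + h) \<le> exp h * (exp (t0 - t) * sinh L)"
  proof -
    have "sinh (L - t) * cosh (t0 + h) \<le> (exp (- t) * sinh L) * (exp h * exp t0)"
      using sinh_diff_le[of t L] cosh_add_le[of t0 h] cosh_le_exp[of t0] t tt h0 L
      by (intro mult_mono order_trans[OF cosh_add_le]) auto
    then show ?thesis by (simp add: exp_diff exp_minus field_simps)
  qed
  have b: "sinh t * cosh ((L - t0) + h) \<le> exp h * (exp (t0 - t) * sinh L)"
  proof -
    have "sinh t * cosh ((L - t0) + h) \<le> sinh t0 * (exp h * cosh (L - t0))"
      using t tt h0 by (intro mult_mono cosh_add_le) auto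
    also have "\<dots> = exp h * (sinh t0 * cosh (L - t0))" by simp
    also have "\<dots> \<le> exp h * sinh L"
    proof -
      have "0 \<le> sinh (L - t0) * cosh t0" using h0 by simp
      then show ?thesis
        using sinh_cosh_split[of L t0] by (intro mult_left_mono) auto
    qed
    also have "\<dots> \<le> exp h * (exp (t0 - t) * sinh L)"
      using tt L by (intro mult_left_mono) (auto intro!: mult_right_mono[of 1, simplified])
    finally show ?thesis .
  qed
  \<comment> \<open>Adding the two equal bounds \<open>a\<close> and \<open>b\<close> costs one
    \<open>ln 2\<close>, the passage from \<open>cosh\<close> to \<open>exp\<close> a second one.
    The Gromov product halves the sum.\<close>
  have "cosh (dist y (c t)) * sinh L \<le> (2 * exp h * exp (t0 - t)) * sinh L"
    using CAT_neg1_stewart[OF CAT c, of t y] t tt a b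
    unfolding L_def[symmetric] dyx dyz by (simp add: algebra_simps)
  then have "cosh (dist y (c t)) \<le> 2 * exp h * exp (t0 - t)"
    using L by simp
  then have "exp (dist y (c t)) \<le> exp (2 * ln 2 + h + (t0 - t))"
    using exp_le_2_cosh[of "dist y (c t)"] by (simp add: exp_add exp_double power2_eq_square)
  then have "dist y (c t) \<le> 2 * ln 2 + h + (t0 - t)" by simp
  moreover have "dist x (c t) = t" using geodesicD(4)[OF c] t tt by (simp add: L_def)
  ultimately show ?thesis by (simp add: gromov_product_def h_def dist_commute)
qed

text \<open>At the point of the side that corresponds to the centre of the comparison tripod, the
  two terms of Stewart's inequality combine, by the addition theorem for \<open>sinh\<close>, into a
  multiple of \<open>sinh L\<close>. The \<open>ln 2\<close> is the loss from \<open>cosh\<close> to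
  \<open>exp\<close>.\<close>

lemma CAT_neg1_projection:
  fixes p q z :: "'a::metric_space"
  assumes CAT: "CAT_neg1 TYPE('a)" and c: "geodesic UNIV dist c p q"
  shows "dist z (c (gromov_product dist p z q)) \<le> gromov_product dist z p q + ln 2"
proof (cases "p = q")
  case True
  then show ?thesis using geodesicD(1)[OF c] by (simp add: gromov_product_def dist_commute)
next
  case False
  define L t h where "L = dist p q" and "t = gromov_product dist p z q"
    and "h = gromov_product dist z p q"
  have L: "L > 0" using False by (simp add: L_def)
  have tri: "0 \<le> t" "t \<le> L" "0 \<le> h"
    unfolding L_def t_def h_def gromov_product_def
    using dist_triangle[of p z q] dist_triangle[of z q p] dist_triangle[of p q z]
    by (auto simp: dist_commute)
  have d: "dist z p = t + h" "dist z q = (L - t) + h"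
    by (auto simp: L_def t_def h_def gromov_product_def dist_commute field_simps)
  have "cosh (dist z (c t)) * sinh L \<le> sinh (L - t) * cosh (t + h) + sinh t * cosh ((L - t) + h)"
    using CAT_neg1_stewart[OF CAT c, of t z] tri unfolding L_def[symmetric] d by simp
  also have "\<dots> \<le> sinh (L - t) * (exp h * cosh t) + sinh t * (exp h * cosh (L - t))"
    using tri by (intro add_mono mult_left_mono cosh_add_le) auto
  also have "\<dots> = exp h * sinh L"
    by (simp only: sinh_cosh_split[of L t, symmetric] algebra_simps)
  finally have "cosh (dist z (c t)) \<le> exp h" using L by simp
  then have "exp (dist z (c t)) \<le> exp (h + ln 2)"
    using exp_le_2_cosh[of "dist z (c t)"] by (simp add: exp_add)
  then show ?thesis by (simp add: t_def h_def)
qed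

lemma geodesic_reverse:
  assumes "geodesic UNIV dist c x y"
  shows "geodesic UNIV dist (\<lambda>t. c (dist x y - t)) y x"
  using assms by (auto simp: geodesic_def dist_commute)

lemma gromov_product_change_base:
  "gromov_product dist w x y \<le> gromov_product dist m x y + dist w m"
  using dist_triangle[of x w m] dist_triangle[of y w m]
  by (simp add: gromov_product_def dist_commute field_simps)

lemma gromov_product_commute: "gromov_product dist w x y = gromov_product dist w y x"
  by (simp add: gromov_product_def dist_commute)

text \<open>Let \<open>m\<close> be the approximate projection of \<open>w\<close> to the side from
  \<open>x\<close> to \<open>z\<close>. Wherever \<open>y\<close> projects to this side,
  \<open>m\<close> lies between that projection and one of the two ends, so seen from
  \<open>m\<close> the product of \<open>y\<close> with that end is at most \<open>ln 2\<close>.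
  Going back to \<open>w\<close> costs \<open>dist w m\<close>, which exceeds the product of
  \<open>x\<close> and \<open>z\<close> by at most \<open>ln 2\<close>.\<close>

lemma CAT_neg1_four_point:
  fixes w x y z :: "'a::metric_space"
  assumes CAT: "CAT_neg1 TYPE('a)"
  shows "min (gromov_product dist w x y) (gromov_product dist w y z) - 2 * ln 2
       \<le> gromov_product dist w x z"
proof -
  obtain c where c: "geodesic UNIV dist c x z" using CAT unfolding CAT_neg1_def by blast
  define t where "t = gromov_product dist x w z"
  define m where "m = c t"
  have t: "0 \<le> t" "t \<le> dist x z"
    unfolding t_def gromov_product_def
    using dist_triangle[of w z x] dist_triangle[of w x z] dist_triangle[of x z w]
    by (auto simp: dist_commute)
  have d: "dist w m \<le> gromov_product dist w x z + ln 2"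
    unfolding m_def t_def by (rule CAT_neg1_projection[OF CAT c])
  have "gromov_product dist m x y \<le> ln 2 \<or> gromov_product dist m y z \<le> ln 2"
  proof (cases "t \<le> gromov_product dist x y z")
    case True
    then show ?thesis using CAT_neg1_near_side[OF CAT c t(1)] by (simp add: m_def)
  next
    case False
    have "gromov_product dist x y z + gromov_product dist z y x = dist x z"
      by (simp add: gromov_product_def dist_commute field_simps)
    then have "dist z x - t \<le> gromov_product dist z y x" using False by (simp add: dist_commute)
    then have "gromov_product dist (c (dist x z - (dist z x - t))) z y \<le> ln 2"
      using CAT_neg1_near_side[OF CAT geodesic_reverse[OF c], of "dist z x - t" y] t
      by (simp add: dist_commute)
    then show ?thesis
      by (simp add: m_def dist_commute gromov_product_commute[of _ z y])
  qed
  then show ?thesis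
    using d gromov_product_change_base[of w x y m] gromov_product_change_base[of w y z m]
    by (auto simp: min_def)
qed


section \<open>Busemann functions as limits\<close>

text \<open>Arzela-Ascoli for curves: a diagonal subsequence converges at rational times, and the
  common Lipschitz constant carries the Cauchy property to all real times.\<close>

lemma lipschitz_pointwise_subseq:
  fixes f :: "nat \<Rightarrow> real \<Rightarrow> 'a::metric_space"
  assumes lip: "\<And>n s t. dist (f n s) (f n t) \<le> \<bar>s - t\<bar>"
    and K: "\<And>t. compact (K t)" "\<And>n t. f n t \<in> K t"
  obtains r g where "strict_mono (r :: nat \<Rightarrow> nat)" "\<And>t. (\<lambda>n. f (r n) t) \<longlonglongrightarrow> g t"
proof -
  define q where "q n = real_of_rat (from_nat n)" for n
  let ?P = "\<lambda>n s. convergent (\<lambda>k. f (s k) (q n))"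
  interpret subseqs ?P
  proof
    fix n and s :: "nat \<Rightarrow> nat" assume "strict_mono s"
    obtain l r' where "strict_mono r'" "((\<lambda>k. f (s k) (q n)) \<circ> r') \<longlonglongrightarrow> l"
      using K(1)[of "q n", unfolded compact_def, rule_format, of "\<lambda>k. f (s k) (q n)"] K(2) by auto
    then show "\<exists>r'. strict_mono r' \<and> ?P n (s \<circ> r')"
      by (auto simp: convergent_def o_def)
  qed
  have conv: "convergent (\<lambda>k. f (diagseq k) (q n))" for n
  proof -
    \<comment> \<open>Only a tail of the diagonal sequence refines the choice made for
      \<open>q n\<close>, hence the shift by \<open>Suc n\<close>.\<close>
    have "?P n (diagseq \<circ> (+) (Suc n))"
    proof (rule diagseq_holds)
      fix r s and n :: nat assume "strict_mono (r :: nat \<Rightarrow> nat)" "?P n s"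
      then show "?P n (s \<circ> r)"
        using convergent_subseq_convergent[of "\<lambda>k. f (s k) (q n)" r] by (simp add: o_def)
    qed
    then have "convergent (\<lambda>k. f (diagseq (k + Suc n)) (q n))"
      by (simp add: o_def add.commute)
    then show ?thesis
      by (subst (asm) convergent_ignore_initial_segment)
  qed
  have "\<exists>l. (\<lambda>k. f (diagseq k) t) \<longlonglongrightarrow> l" for t
  proof -
    have "Cauchy (\<lambda>k. f (diagseq k) t)"
    proof (rule metric_CauchyI)
      fix e :: real assume e: "e > 0"
      obtain u where u: "t < real_of_rat u" "real_of_rat u < t + e / 3"
        using of_rat_dense[of t "t + e / 3"] e by auto
      obtain n where n: "q n = real_of_rat u" unfolding q_def by (metis from_nat_to_nat)
      have "Cauchy (\<lambda>k. f (diagseq k) (q n))" using conv convergent_Cauchy by blast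
      then obtain M where M: "\<And>i j. \<lbrakk>i \<ge> M; j \<ge> M\<rbrakk> \<Longrightarrow> dist (f (diagseq i) (q n)) (f (diagseq j) (q n)) < e / 3"
        using e unfolding Cauchy_def by (metis divide_pos_pos zero_less_numeral)
      have "dist (f (diagseq i) t) (f (diagseq j) t) < e" if "i \<ge> M" "j \<ge> M" for i j
      proof -
        have "dist (f (diagseq i) t) (f (diagseq i) (q n)) < e / 3"
          "dist (f (diagseq j) (q n)) (f (diagseq j) t) < e / 3"
          using lip[of "diagseq i" t "q n"] lip[of "diagseq j" "q n" t] u n by linarith+
        then show ?thesis
          using M[OF that] dist_triangle[of "f (diagseq i) t" "f (diagseq j) t" "f (diagseq i) (q n)"]
            dist_triangle[of "f (diagseq i) (q n)" "f (diagseq j) t" "f (diagseq j) (q n)"] by linarith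
      qed
      then show "\<exists>M. \<forall>m\<ge>M. \<forall>n\<ge>M. dist (f (diagseq m) t) (f (diagseq n) t) < e" by blast
    qed
    then show ?thesis
      using compact_imp_complete[OF K(1)[of t]] K(2) completeE[of "K t" "\<lambda>k. f (diagseq k) t"] by metis
  qed
  then show ?thesis using that subseq_diagseq by metis
qed

lemma limit_ray:
  fixes p :: "'a::metric_space"
  assumes "proper_space TYPE('a)" and c: "\<And>n. geodesic UNIV dist (c n) p (X n)"
    and inf: "filterlim (\<lambda>n. dist p (X n)) at_top sequentially"
  obtains r a where "strict_mono (r :: nat \<Rightarrow> nat)" "a \<in> geodesic_rays" "a 0 = p"
    "\<And>t. t \<ge> 0 \<Longrightarrow> (\<lambda>n. c (r n) t) \<longlonglongrightarrow> a t"
proof -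
  \<comment> \<open>Clamping the time makes every \<open>f n\<close> 1-Lipschitz on all reals, as
    the diagonal argument requires. For fixed \<open>t \<ge> 0\<close> and large \<open>n\<close> it
    changes nothing.\<close>
  define f where "f n t = c n (max 0 (min t (dist p (X n))))" for n t
  have 1: "dist (f n s) (f n t) \<le> \<bar>s - t\<bar>" for n s t
    unfolding f_def by (subst geodesicD(3)[OF c]) auto
  have 2: "f n t \<in> cball p \<bar>t\<bar>" for n t
    unfolding f_def mem_cball by (subst geodesicD(4)[OF c]) auto
  have 3: "compact (cball p \<bar>t\<bar>)" for t
    using assms(1) unfolding proper_space_def by blast
  obtain r a where r: "strict_mono (r :: nat \<Rightarrow> nat)" and a: "\<And>t. (\<lambda>n. f (r n) t) \<longlonglongrightarrow> a t"
    using lipschitz_pointwise_subseq[of f, OF 1 3 2] by metis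
  have large: "\<forall>\<^sub>F n in sequentially. t \<le> dist p (X (r n))" for t
    using filterlim_compose[OF inf filterlim_subseq[OF r]] by (auto simp: filterlim_at_top)
  have fc: "\<forall>\<^sub>F n in sequentially. f (r n) t = c (r n) t" if "t \<ge> 0" for t
    using large[of t] by eventually_elim (use that in \<open>simp add: f_def\<close>)
  have ca: "(\<lambda>n. c (r n) t) \<longlonglongrightarrow> a t" if "t \<ge> 0" for t
    using a[of t] fc[OF that] by (rule Lim_transform_eventually)
  have "dist (a s) (a t) = \<bar>s - t\<bar>" if "s \<ge> 0" "t \<ge> 0" for s t
  proof (rule LIMSEQ_unique)
    show "(\<lambda>n. dist (c (r n) s) (c (r n) t)) \<longlonglongrightarrow> dist (a s) (a t)"
      by (intro tendsto_dist ca that)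
    have "\<forall>\<^sub>F n in sequentially. \<bar>s - t\<bar> = dist (c (r n) s) (c (r n) t)"
      using large[of s] large[of t]
      by eventually_elim (use that geodesicD(3)[OF c] in auto)
    then show "(\<lambda>n. dist (c (r n) s) (c (r n) t)) \<longlonglongrightarrow> \<bar>s - t\<bar>"
      by (rule Lim_transform_eventually[OF tendsto_const])
  qed
  moreover have "a 0 = p"
    using ca[of 0] geodesicD(1)[OF c] LIMSEQ_unique[OF tendsto_const[of p]] by auto
  ultimately show ?thesis using that[OF r _ _ ca] by (auto simp: geodesic_rays_def)
qed

text \<open>The half of the Busemann limit that needs curvature; the other half is the triangle
  inequality. Stewart's inequality is rewritten so that \<open>exp (dist x z - dist p x)\<close> is
  bounded below by its counterpart at time \<open>t\<close>, with errors that vanish as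
  \<open>x\<close> recedes and then \<open>t\<close> grows.\<close>

lemma CAT_neg1_exp_estimate:
  fixes p x z :: "'a::metric_space"
  assumes CAT: "CAT_neg1 TYPE('a)" and c: "geodesic UNIV dist c p x"
    and t: "0 \<le> t" "t \<le> dist p x"
  shows "(exp (dist (c t) z - t) - 2 * exp (- 2 * t) * cosh (dist p z)) * (1 - exp (- 2 * dist p x))
       \<le> exp (dist x z - dist p x) + exp (- dist p x)"
proof -
  define L D R d where "L = dist p x" and "D = dist x z" and "R = dist p z" and "d = dist (c t) z"
  have H: "cosh d * sinh L \<le> sinh (L - t) * cosh R + sinh t * cosh D"
    using CAT_neg1_stewart[OF CAT c t, of z] by (simp add: L_def D_def R_def d_def dist_commute)
  have L: "L \<ge> 0" "t \<le> L" using t by (auto simp: L_def)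
  have "exp d * sinh L \<le> 2 * cosh d * sinh L"
    using L exp_le_2_cosh[of d] by (intro mult_right_mono) auto
  also have "\<dots> \<le> 2 * ((exp (- t) * sinh L) * cosh R) + 2 * ((exp t / 2) * ((exp D + 1) / 2))"
  proof -
    have "sinh (L - t) * cosh R \<le> (exp (- t) * sinh L) * cosh R"
      using sinh_diff_le[of t L] t L by (intro mult_right_mono) auto
    moreover have "sinh t * cosh D \<le> (exp t / 2) * ((exp D + 1) / 2)"
      using t by (intro mult_mono) (auto simp: sinh_def cosh_def D_def)
    ultimately show ?thesis using H by linarith
  qed
  finally have H': "exp d * sinh L
      \<le> 2 * (exp (- t) * sinh L * cosh R) + 2 * ((exp t / 2) * ((exp D + 1) / 2))" .
  define u v where "u = exp (- t)" and "v = exp (- L)"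
  have uv: "exp t * u = 1" "2 * sinh L * v = 1 - v\<^sup>2" "exp (- 2 * t) = u\<^sup>2" "exp (- 2 * L) = v\<^sup>2"
    by (simp_all add: u_def v_def sinh_def algebra_simps exp_add[symmetric] exp_double[symmetric])
  \<comment> \<open>The factor \<open>2 * v * u\<close> turns \<open>exp d * sinh L\<close> into
    \<open>exp (d - t)\<close> times a number close to 1 for large \<open>L\<close>.\<close>
  have "exp d * u * (1 - v\<^sup>2) = (exp d * sinh L) * (2 * v * u)"
    by (simp add: uv(2)[symmetric])
  also have "\<dots> \<le> (2 * (u * sinh L * cosh R) + 2 * ((exp t / 2) * ((exp D + 1) / 2))) * (2 * v * u)"
    using H' by (intro mult_right_mono) (auto simp: u_def v_def)
  also have "\<dots> = 2 * u\<^sup>2 * cosh R * (2 * sinh L * v) + (exp t * u) * (exp D + 1) * v"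
    by (simp add: field_simps power2_eq_square)
  finally have "(exp d * u - 2 * u\<^sup>2 * cosh R) * (1 - v\<^sup>2) \<le> exp D * v + v"
    unfolding uv by (simp add: algebra_simps)
  then have "(exp (d - t) - 2 * exp (- 2 * t) * cosh R) * (1 - exp (- 2 * L)) \<le> exp (D - L) + exp (- L)"
    unfolding uv by (simp add: u_def v_def exp_add[symmetric])
  then show ?thesis by (simp add: L_def D_def R_def d_def)
qed

text \<open>By the triangle inequality the function is nonincreasing in \<open>t\<close>, so its
  limit is its infimum. The bound at finite times is used for the lower half of the convergence to
  Busemann functions.\<close>

lemma busemann_limit_exists:
  fixes a :: "real \<Rightarrow> 'a::metric_space"
  assumes a: "a \<in> geodesic_rays"
  obtains \<beta> where "((\<lambda>t. dist (a t) z - t) \<longlongrightarrow> \<beta>) at_top" "\<And>t. t \<ge> 0 \<Longrightarrow> \<beta> \<le> dist (a t) z - t"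
proof -
  define \<phi> where "\<phi> t = dist (a t) z - t" for t
  have iso: "dist (a s) (a t) = \<bar>s - t\<bar>" if "s \<ge> 0" "t \<ge> 0" for s t
    using a that by (auto simp: geodesic_rays_def)
  have mono: "\<phi> t \<le> \<phi> s" if "0 \<le> s" "s \<le> t" for s t
    using iso[of t s] that dist_triangle[of "a t" z "a s"] by (simp add: \<phi>_def)
  have "bdd_below (\<phi> ` {0..})"
  proof (rule bdd_belowI2)
    fix t :: real assume "t \<in> {0..}"
    then show "- dist (a 0) z \<le> \<phi> t"
      using iso[of 0 t] dist_triangle3[of "a 0" "a t" z] by (auto simp: \<phi>_def dist_commute)
  qed
  then have lower: "Inf (\<phi> ` {0..}) \<le> \<phi> t" if "t \<ge> 0" for t
    using that by (intro cInf_lower) auto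
  have "(\<phi> \<longlongrightarrow> Inf (\<phi> ` {0..})) at_top"
  proof (rule order_tendstoI)
    fix u assume u: "u < Inf (\<phi> ` {0..})"
    show "\<forall>\<^sub>F t in at_top. u < \<phi> t"
      using eventually_ge_at_top[of 0] by eventually_elim (use u lower in force)
  next
    fix u assume "Inf (\<phi> ` {0..}) < u"
    then obtain s where s: "s \<ge> 0" "\<phi> s < u"
      using cInf_lessD[of "\<phi> ` {0..}" u] by auto
    show "\<forall>\<^sub>F t in at_top. \<phi> t < u"
      using eventually_ge_at_top[of s] by eventually_elim (use mono s in force)
  qed
  then show ?thesis using that lower unfolding \<phi>_def by blast
qed

text \<open>The time \<open>t\<close> is fixed first, and only then does \<open>n\<close> tend to
  infinity, when \<open>c n t\<close> approaches \<open>a t\<close>. Exponentials are compared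
  because the lower estimate is multiplicative; \<open>ln\<close> returns to distances.\<close>

lemma geodesics_tendsto_ray_imp_busemann:
  fixes p :: "'a::metric_space"
  assumes CAT: "CAT_neg1 TYPE('a)" and c: "\<And>n. geodesic UNIV dist (c n) p (X n)"
    and inf: "filterlim (\<lambda>n. dist p (X n)) at_top sequentially"
    and a: "a \<in> geodesic_rays" and ca: "\<And>t. t \<ge> 0 \<Longrightarrow> (\<lambda>n. c n t) \<longlonglongrightarrow> a t"
    and \<beta>: "((\<lambda>t. dist (a t) z - t) \<longlongrightarrow> \<beta>) at_top"
  shows "(\<lambda>n. dist (X n) z - dist p (X n)) \<longlonglongrightarrow> \<beta>"
proof -
  obtain \<beta>' where "((\<lambda>t. dist (a t) z - t) \<longlongrightarrow> \<beta>') at_top" "\<And>t. t \<ge> 0 \<Longrightarrow> \<beta>' \<le> dist (a t) z - t"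
    using busemann_limit_exists[OF a, where z = z] by blast
  then have below: "\<beta> \<le> dist (a t) z - t" if "t \<ge> 0" for t
    using that tendsto_unique[OF _ \<beta>] by fastforce
  have large: "\<forall>\<^sub>F n in sequentially. t \<le> dist p (X n)" for t
    using inf by (auto simp: filterlim_at_top)
  have lim_d: "(\<lambda>n. exp (dist (c n t) z - t)) \<longlonglongrightarrow> exp (dist (a t) z - t)" if "t \<ge> 0" for t
    by (intro tendsto_intros ca that)
  have exp\<beta>: "((\<lambda>t. exp (dist (a t) z - t)) \<longlongrightarrow> exp \<beta>) at_top"
    by (intro tendsto_exp \<beta>)
  have exp0: "(\<lambda>n. exp (- dist p (X n))) \<longlonglongrightarrow> 0"
    using filterlim_compose[OF exp_at_bot] inf by (simp add: filterlim_uminus_at_top)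
  have "(\<lambda>n. exp (- dist p (X n)) * exp (- dist p (X n))) \<longlonglongrightarrow> 0 * 0"
    by (intro tendsto_mult exp0)
  then have exp0': "(\<lambda>n. exp (- 2 * dist p (X n))) \<longlonglongrightarrow> 0"
    by (simp add: exp_add[symmetric])
  have "(\<lambda>n. exp (dist (X n) z - dist p (X n))) \<longlonglongrightarrow> exp \<beta>"
  proof (rule order_tendstoI)
    fix u assume "exp \<beta> < u"
    then have "\<forall>\<^sub>F t in at_top. exp (dist (a t) z - t) < u"
      using exp\<beta> by (rule order_tendstoD(2)[rotated])
    then have "\<forall>\<^sub>F t in at_top. t \<ge> 0 \<and> exp (dist (a t) z - t) < u"
      using eventually_ge_at_top[of 0] by eventually_elim auto
    then obtain t where t: "t \<ge> 0" "exp (dist (a t) z - t) < u"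
      using eventually_happens by force
    have "\<forall>\<^sub>F n in sequentially. exp (dist (c n t) z - t) < u"
      using lim_d[OF t(1)] t(2) by (rule order_tendstoD(2))
    then show "\<forall>\<^sub>F n in sequentially. exp (dist (X n) z - dist p (X n)) < u"
      using large[of t]
    proof eventually_elim
      case (elim n)
      have "dist (X n) z \<le> (dist p (X n) - t) + dist (c n t) z"
        using geodesicD(5)[OF c t(1) elim(2)] dist_triangle[of "X n" z "c n t"]
        by (simp add: dist_commute)
      then have "exp (dist (X n) z - dist p (X n)) \<le> exp (dist (c n t) z - t)" by simp
      then show ?case using elim(1) by linarith
    qed
  next
    fix u assume u: "u < exp \<beta>"
    define R where "R = 2 * cosh (dist p z)"
    have "((\<lambda>t. exp (- 2 * t) * R) \<longlongrightarrow> 0 * R) at_top"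
      by (intro tendsto_mult tendsto_const filterlim_compose[OF exp_at_bot])
         (real_asymp)
    then have "\<forall>\<^sub>F t in at_top. exp (- 2 * t) * R < exp \<beta> - u"
      using u by (intro order_tendstoD(2)[of _ "0 * R"]) auto
    then have "\<forall>\<^sub>F t in at_top. t \<ge> 0 \<and> exp (- 2 * t) * R < exp \<beta> - u"
      using eventually_ge_at_top[of 0] by eventually_elim auto
    then obtain t where t: "t \<ge> 0" "exp (- 2 * t) * R < exp \<beta> - u"
      using eventually_happens by force
    have "exp \<beta> \<le> exp (dist (a t) z - t)" using below[OF t(1)] by simp
    then have "u < exp (dist (a t) z - t) - exp (- 2 * t) * R"
      using t by linarith
    then have "u < (exp (dist (a t) z - t) - exp (- 2 * t) * R) * (1 - 0) - 0"
      by simp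
    moreover have "(\<lambda>n. (exp (dist (c n t) z - t) - exp (- 2 * t) * R)
        * (1 - exp (- 2 * dist p (X n))) - exp (- dist p (X n)))
      \<longlonglongrightarrow> (exp (dist (a t) z - t) - exp (- 2 * t) * R) * (1 - 0) - 0"
      by (intro tendsto_diff tendsto_mult tendsto_const exp0 exp0' lim_d t)
    ultimately have "\<forall>\<^sub>F n in sequentially. u < (exp (dist (c n t) z - t) - exp (- 2 * t) * R)
        * (1 - exp (- 2 * dist p (X n))) - exp (- dist p (X n))"
      by (intro order_tendstoD(1))
    then show "\<forall>\<^sub>F n in sequentially. u < exp (dist (X n) z - dist p (X n))"
      using large[of t]
    proof eventually_elim
      case (elim n)
      then show ?case
        using CAT_neg1_exp_estimate[OF CAT c t(1) elim(2), of z] by (simp add: R_def algebra_simps)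
    qed
  qed
  then have "(\<lambda>n. ln (exp (dist (X n) z - dist p (X n)))) \<longlonglongrightarrow> ln (exp \<beta>)"
    by (intro tendsto_ln) auto
  then show ?thesis by simp
qed

text \<open>Stewart's inequality is applied to the side \<open>c\<close> seen from
  \<open>c' T\<close> and to the side \<open>c'\<close> seen from \<open>c s\<close>, and the
  distance from \<open>c s\<close> to \<open>c' T\<close>, common to both, is eliminated. The
  right-hand side that is left does not depend on \<open>T\<close>, while \<open>sinh T\<close> is
  unbounded. This makes \<open>busemann\<close> independent of the ray that \<open>SOME\<close>
  picks.\<close>

lemma asymptotic_rays_eq:
  fixes c c' :: "real \<Rightarrow> 'a::metric_space"
  assumes CAT: "CAT_neg1 TYPE('a)" and rays: "c \<in> geodesic_rays" "c' \<in> geodesic_rays"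
    and start: "c 0 = c' 0" and B: "\<And>t. t \<ge> 0 \<Longrightarrow> dist (c t) (c' t) \<le> B" and s: "s \<ge> 0"
  shows "c s = c' s"
proof -
  define x where "x = dist (c s) (c' s)"
  have geo: "geodesic UNIV dist e (e 0) (e T)" and len: "dist (e 0) (e T) = T"
    if "e \<in> geodesic_rays" "T \<ge> 0" for e :: "real \<Rightarrow> 'a" and T
    using that by (auto simp: geodesic_def geodesic_rays_def)
  have B0: "B \<ge> 0" using B[of 0] start by simp
  have bound: "(cosh x - 1) * (sinh T)\<^sup>2 \<le> (sinh s)\<^sup>2 * cosh B" if T: "T \<ge> s" for T
  proof -
    have T0: "T \<ge> 0" using s T by simp
    define D where "D = cosh (dist (c' T) (c s))"
    have "D * sinh T \<le> sinh (T - s) * cosh (dist (c' T) (c 0)) + sinh s * cosh (dist (c' T) (c T))"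
      using CAT_neg1_stewart[OF CAT geo[OF rays(1) T0], of s "c' T"] s T len[OF rays(1) T0]
      by (simp add: D_def)
    also have "\<dots> \<le> sinh (T - s) * cosh T + sinh s * cosh B"
      using len[OF rays(2) T0] start B[OF T0] s T B0
      by (intro add_mono mult_left_mono cosh_real_nonneg_le_iff[THEN iffD2])
         (auto simp: dist_commute)
    finally have 1: "D * sinh T \<le> sinh (T - s) * cosh T + sinh s * cosh B" .
    have 2: "cosh x * sinh T \<le> sinh (T - s) * cosh s + sinh s * D"
      using CAT_neg1_stewart[OF CAT geo[OF rays(2) T0], of s "c s"] s T len[OF rays(2) T0]
        len[OF rays(1) s] start
      by (simp add: D_def x_def dist_commute)
    have "cosh x * sinh T * sinh T \<le> (sinh (T - s) * cosh s + sinh s * D) * sinh T"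
      using 2 T0 by (intro mult_right_mono) auto
    also have "\<dots> = sinh (T - s) * cosh s * sinh T + sinh s * (D * sinh T)"
      by (simp add: algebra_simps)
    also have "\<dots> \<le> sinh (T - s) * cosh s * sinh T + sinh s * (sinh (T - s) * cosh T + sinh s * cosh B)"
      using 1 s by (intro add_left_mono mult_left_mono) auto
    also have "\<dots> = sinh (T - s) * sinh (T + s) + (sinh s)\<^sup>2 * cosh B"
      by (simp add: sinh_add algebra_simps power2_eq_square)
    also have "sinh (T - s) * sinh (T + s) = (sinh T)\<^sup>2 * (cosh s)\<^sup>2 - (cosh T)\<^sup>2 * (sinh s)\<^sup>2"
      by (simp add: sinh_add sinh_diff algebra_simps power2_eq_square)
    also have "\<dots> = (sinh T)\<^sup>2 - (sinh s)\<^sup>2"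
      by (simp add: cosh_square_eq algebra_simps)
    finally have "cosh x * sinh T * sinh T \<le> (sinh T)\<^sup>2 - (sinh s)\<^sup>2 + (sinh s)\<^sup>2 * cosh B" .
    moreover have "(cosh x - 1) * (sinh T)\<^sup>2 = cosh x * sinh T * sinh T - (sinh T)\<^sup>2"
      by (simp add: algebra_simps power2_eq_square)
    ultimately show ?thesis
      using zero_le_power2[of "sinh s"] by linarith
  qed
  have "cosh x \<le> 1"
  proof (rule ccontr)
    assume "\<not> cosh x \<le> 1"
    then have pos: "cosh x - 1 > 0" by simp
    have "filterlim (\<lambda>T :: real. (cosh x - 1) * (sinh T)\<^sup>2) at_top at_top"
      by (intro filterlim_tendsto_pos_mult_at_top[OF tendsto_const pos] filterlim_pow_at_top
          sinh_real_at_top) auto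
    then have "\<forall>\<^sub>F T in at_top. (cosh x - 1) * (sinh T)\<^sup>2 > (sinh s)\<^sup>2 * cosh B"
      by (auto simp: filterlim_at_top_dense)
    then have "\<forall>\<^sub>F T in at_top. T \<ge> s \<and> (cosh x - 1) * (sinh T)\<^sup>2 > (sinh s)\<^sup>2 * cosh B"
      using eventually_ge_at_top[of s] by eventually_elim auto
    then obtain T where "T \<ge> s" "(cosh x - 1) * (sinh T)\<^sup>2 > (sinh s)\<^sup>2 * cosh B"
      using eventually_happens by force
    then show False using bound[of T] by linarith
  qed
  then have "x = 0" using cosh_real_ge_1[of x] by (simp add: antisym)
  then show ?thesis by (simp add: x_def)
qed

lemma exists_asymptotic_ray:
  fixes c :: "real \<Rightarrow> 'a::metric_space"
  assumes CAT: "CAT_neg1 TYPE('a)" and proper: "proper_space TYPE('a)"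
    and c: "c \<in> geodesic_rays"
  shows "\<exists>a. (c, a) \<in> asymptotic_rel \<and> a 0 = p"
proof -
  define X where "X n = c (real n)" for n
  define R where "R = dist p (c 0)"
  have iso: "dist (c s) (c t) = \<bar>s - t\<bar>" if "s \<ge> 0" "t \<ge> 0" for s t
    using c that by (auto simp: geodesic_rays_def)
  have X: "\<bar>dist p (X n) - real n\<bar> \<le> R" for n
    using iso[of 0 n] dist_triangle[of p "X n" "c 0"] dist_triangle3[of "c 0" "X n" p]
    by (auto simp: X_def R_def dist_commute)
  have inf: "filterlim (\<lambda>n. dist p (X n)) at_top sequentially"
  proof (rule filterlim_at_top_mono)
    show "filterlim (\<lambda>n. - R + real n) at_top sequentially"
      by (intro filterlim_tendsto_add_at_top[OF tendsto_const] filterlim_real_sequentially)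
    show "\<forall>\<^sub>F n in sequentially. - R + real n \<le> dist p (X n)"
      using X by (intro always_eventually allI) (metis abs_diff_le_iff add.commute uminus_add_conv_diff)
  qed
  have "\<exists>e. geodesic UNIV dist e p (X n)" for n using CAT unfolding CAT_neg1_def by blast
  then obtain e where e: "\<And>n. geodesic UNIV dist (e n) p (X n)" by metis
  obtain r a where r: "strict_mono (r :: nat \<Rightarrow> nat)" and a: "a \<in> geodesic_rays" "a 0 = p"
    and lim: "\<And>t. t \<ge> 0 \<Longrightarrow> (\<lambda>n. e (r n) t) \<longlonglongrightarrow> a t"
    using limit_ray[OF proper e inf] by metis
  \<comment> \<open>Seen from \<open>X n\<close>, consecutive points among \<open>e n t\<close>,
    \<open>p\<close>, \<open>c 0\<close>, \<open>c t\<close> have large products. The four-point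
    condition is used twice, at a loss of \<open>2 * ln 2\<close> each time, and the distance is
    read off from twice a product, whence \<open>8 * ln 2\<close>. It matters that the bound is
    independent of \<open>n\<close>.\<close>
  have close: "dist (e n t) (c t) \<le> 4 * R + 8 * ln 2"
    if t: "t \<ge> 0" "t \<le> dist p (X n)" "t \<le> real n" for n t
  proof -
    have d: "dist (X n) (e n t) = dist p (X n) - t" "dist p (e n t) = t"
      "dist (X n) (c t) = real n - t" "dist (c 0) (c t) = t" "dist (X n) (c 0) = real n"
      using geodesicD(4,5)[OF e, of t n] iso[of n t] iso[of 0 t] iso[of n 0] t
      by (auto simp: X_def dist_commute)
    have 1: "gromov_product dist (X n) (e n t) p = dist p (X n) - t"
      "gromov_product dist (X n) p (c 0) = (dist p (X n) + real n - R) / 2"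
      "gromov_product dist (X n) (c 0) (c t) = real n - t"
      "gromov_product dist (X n) (e n t) (c t) = (dist p (X n) - t + (real n - t) - dist (e n t) (c t)) / 2"
      unfolding gromov_product_def using d by (auto simp: dist_commute R_def)
    define l :: real where "l = ln 2"
    have l: "l > 0" by (simp add: l_def)
    show ?thesis
      using CAT_neg1_four_point[OF CAT, of "X n" "e n t" p "c 0"]
        CAT_neg1_four_point[OF CAT, of "X n" "e n t" "c 0" "c t"] t l X[of n]
      unfolding 1 min_def l_def[symmetric] by (simp add: field_simps split: if_splits)
  qed
  have "dist (c t) (a t) \<le> 4 * R + 8 * ln 2" if t: "t \<ge> 0" for t
  proof (rule tendsto_upperbound)
    show "(\<lambda>n. dist (c t) (e (r n) t)) \<longlonglongrightarrow> dist (c t) (a t)"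
      by (intro tendsto_intros lim t)
    have "\<forall>\<^sub>F n in sequentially. t \<le> dist p (X n)" "\<forall>\<^sub>F n in sequentially. t \<le> real n"
      using inf filterlim_real_sequentially by (auto simp: filterlim_at_top)
    then have "\<forall>\<^sub>F n in sequentially. dist (c t) (e n t) \<le> 4 * R + 8 * ln 2"
      by eventually_elim (use close t in \<open>simp add: dist_commute\<close>)
    then show "\<forall>\<^sub>F n in sequentially. dist (c t) (e (r n) t) \<le> 4 * R + 8 * ln 2"
      by (rule eventually_subseq[OF r])
  qed simp
  then show ?thesis using a c unfolding asymptotic_rel_def by blast
qed

section \<open>Busemann functions of boundary points\<close>

lemma visual_boundaryE:
  fixes \<xi> :: "(real \<Rightarrow> 'a::metric_space) set"
  assumes "CAT_neg1 TYPE('a)" "proper_space TYPE('a)" "\<xi> \<in> visual_boundary"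
  obtains a where "a \<in> \<xi>" "a \<in> geodesic_rays" "a 0 = p"
proof -
  obtain c where "c \<in> geodesic_rays" "\<xi> = asymptotic_rel `` {c}"
    using assms(3) unfolding visual_boundary_def by (auto elim: quotientE)
  moreover then obtain a where "(c, a) \<in> asymptotic_rel" "a 0 = p"
    using exists_asymptotic_ray[OF assms(1,2), of c p] by blast
  ultimately show ?thesis using that by (auto simp: asymptotic_rel_def)
qed

lemma tendsto_busemann:
  fixes \<xi> :: "(real \<Rightarrow> 'a::metric_space) set"
  assumes CAT: "CAT_neg1 TYPE('a)" and \<xi>: "\<xi> \<in> visual_boundary" and a: "a \<in> \<xi>" "a 0 = p"
  shows "((\<lambda>t. dist (a t) z - t) \<longlongrightarrow> busemann p \<xi> z) at_top"
proof -
  obtain e where e: "\<xi> = asymptotic_rel `` {e}"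
    using \<xi> unfolding visual_boundary_def by (auto elim: quotientE)
  define c where "c = (SOME c. c \<in> \<xi> \<and> c 0 = p)"
  have c: "c \<in> \<xi>" "c 0 = p"
    unfolding c_def using someI_ex[of "\<lambda>c. c \<in> \<xi> \<and> c 0 = p"] a by blast+
  obtain B1 B2 where B: "\<And>t. t \<ge> 0 \<Longrightarrow> dist (e t) (c t) \<le> B1" "\<And>t. t \<ge> 0 \<Longrightarrow> dist (e t) (a t) \<le> B2"
    using c a unfolding e asymptotic_rel_def by auto
  have rays: "c \<in> geodesic_rays" "a \<in> geodesic_rays"
    using c a unfolding e asymptotic_rel_def by auto
  have "dist (c t) (a t) \<le> B1 + B2" if "t \<ge> 0" for t
    using B[OF that] dist_triangle3[of "c t" "a t" "e t"] by linarith
  then have eq: "c t = a t" if "t \<ge> 0" for t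
    using asymptotic_rays_eq[OF CAT rays] c a that by metis
  obtain \<beta> where \<beta>: "((\<lambda>t. dist (c t) z - t) \<longlongrightarrow> \<beta>) at_top"
    using busemann_limit_exists[OF rays(1)] by metis
  then have "busemann p \<xi> z = \<beta>"
    unfolding busemann_def c_def[symmetric] Let_def by (intro tendsto_Lim) auto
  moreover have "((\<lambda>t. dist (a t) z - t) \<longlongrightarrow> \<beta>) at_top"
  proof (rule Lim_transform_eventually[OF \<beta>])
    show "\<forall>\<^sub>F t in at_top. dist (c t) z - t = dist (a t) z - t"
      using eventually_ge_at_top[of 0] by eventually_elim (simp add: eq)
  qed
  ultimately show ?thesis by simp
qed

text \<open>Along the ray the function decreases at unit speed. Busemann functions are therefore
  unbounded below, unlike distance functions.\<close>

lemma busemann_attains: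
  fixes \<xi> :: "(real \<Rightarrow> 'a::metric_space) set"
  assumes CAT: "CAT_neg1 TYPE('a)" and proper: "proper_space TYPE('a)"
    and \<xi>: "\<xi> \<in> visual_boundary" and s: "s \<ge> 0"
  obtains z where "busemann p \<xi> z = - s"
proof -
  obtain a where a: "a \<in> \<xi>" "a \<in> geodesic_rays" "a 0 = p"
    using visual_boundaryE[OF CAT proper \<xi>] by metis
  have "busemann p \<xi> (a s) = - s"
  proof (rule tendsto_unique[OF _ tendsto_busemann[OF CAT \<xi> a(1,3)]])
    have "\<forall>\<^sub>F t in at_top. - s = dist (a t) (a s) - t"
      using eventually_ge_at_top[of s] by eventually_elim (use a s in \<open>auto simp: geodesic_rays_def\<close>)
    then show "((\<lambda>t. dist (a t) (a s) - t) \<longlongrightarrow> - s) at_top"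
      by (rule Lim_transform_eventually[OF tendsto_const])
  qed simp
  then show ?thesis using that by blast
qed

lemma exists_busemann_limit:
  fixes p :: "'a::metric_space"
  assumes CAT: "CAT_neg1 TYPE('a)" and proper: "proper_space TYPE('a)"
    and inf: "filterlim (\<lambda>n. dist p (X n)) at_top sequentially"
  obtains \<xi> r where "\<xi> \<in> visual_boundary" "strict_mono (r :: nat \<Rightarrow> nat)"
    "\<And>z. (\<lambda>n. dist (X (r n)) z - dist (X (r n)) p) \<longlonglongrightarrow> busemann p \<xi> z"
proof -
  have "\<exists>e. geodesic UNIV dist e p (X n)" for n using CAT unfolding CAT_neg1_def by blast
  then obtain e where e: "\<And>n. geodesic UNIV dist (e n) p (X n)" by metis
  obtain r a where r: "strict_mono (r :: nat \<Rightarrow> nat)" and a: "a \<in> geodesic_rays" "a 0 = p"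
    and lim: "\<And>t. t \<ge> 0 \<Longrightarrow> (\<lambda>n. e (r n) t) \<longlonglongrightarrow> a t"
    using limit_ray[OF proper e inf] by metis
  define \<xi> where "\<xi> = asymptotic_rel `` {a}"
  have \<xi>: "\<xi> \<in> visual_boundary" "a \<in> \<xi>"
    unfolding \<xi>_def visual_boundary_def
    using a by (intro quotientI, auto simp: asymptotic_rel_def intro!: exI[of _ 0])
  have "(\<lambda>n. dist (X (r n)) z - dist p (X (r n))) \<longlonglongrightarrow> busemann p \<xi> z" for z
    by (rule geodesics_tendsto_ray_imp_busemann[OF CAT e _ a(1) lim])
       (use filterlim_compose[OF inf filterlim_subseq[OF r]] tendsto_busemann[OF CAT \<xi> a(2)] in auto)
  then show ?thesis using that[OF \<xi>(1) r] by (simp add: dist_commute)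
qed


section \<open>Topology of the horofunction compactification\<close>

lemma dmax_le_dist: "dmax x y \<le> dist x y"
  by (simp add: dmax_def dist_fst_le dist_snd_le)

lemma dist_le_dmax: "dist x y \<le> 2 * dmax x y"
proof -
  have "dist x y \<le> dist (fst x) (fst y) + dist (snd x) (snd y)"
    unfolding dist_prod_def by (rule sqrt_sum_squares_le_sum) auto
  then show ?thesis by (simp add: dmax_def)
qed

lemma mtopology_dmax:
  "Metric_space.mtopology UNIV (dmax :: 'a::metric_space \<times> 'b::metric_space \<Rightarrow> _) = euclidean"
proof -
  interpret Metric_space UNIV "dmax :: 'a \<times> 'b \<Rightarrow> _" by (rule Metric_space_dmax)
  have 1: "ball x (e :: real) \<subseteq> mball x e" for x e
    by (auto intro: le_less_trans[OF dmax_le_dist])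
  have 2: "mball x (e / 2) \<subseteq> ball x (e :: real)" for x e
    by (auto intro!: le_less_trans[OF dist_le_dmax])
  have "openin mtopology U \<longleftrightarrow> open U" for U
    unfolding openin_mtopology open_contains_ball
  proof (intro iffI conjI ballI allI impI; (elim conjE)?)
    fix x assume "\<forall>x. x \<in> U \<longrightarrow> (\<exists>r>0. mball x r \<subseteq> U)" "x \<in> U"
    then show "\<exists>e>0. ball x e \<subseteq> U" using 1 by (meson order_trans)
  next
    fix x assume "\<forall>x\<in>U. \<exists>e>0. ball x e \<subseteq> U" "x \<in> U"
    then obtain e where "e > 0" "ball x e \<subseteq> U" by blast
    then show "\<exists>r>0. mball x r \<subseteq> U"
      using 2[of x e] by (intro exI[of _ "e / 2"]) auto
  qed auto
  then show ?thesis by (simp add: topology_eq)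
qed

lemma cont_funs_dmax:
  "cont_funs (dmax :: 'a::metric_space \<times> 'b::metric_space \<Rightarrow> _) = {f. continuous_on UNIV f}"
  by (simp add: cont_funs_def mtopology_dmax)

lemma continuous_on_dmax: "continuous_on UNIV (dmax u)"
  unfolding dmax_def by (intro continuous_intros)

lemma compact_strict_bound:
  fixes g :: "'a::topological_space \<Rightarrow> real"
  assumes "compact K" "continuous_on K g" "\<And>y. y \<in> K \<Longrightarrow> g y < e"
  obtains d where "d > 0" "\<And>y. y \<in> K \<Longrightarrow> g y + d \<le> e"
proof (cases "K = {}")
  case True
  then show ?thesis using that[of 1] by auto
next
  case False
  then obtain x where "x \<in> K" "\<And>y. y \<in> K \<Longrightarrow> g y \<le> g x"
    using continuous_attains_sup[OF assms(1) False assms(2)] by blast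
  then show ?thesis using assms(3)[of x] by (intro that[of "e - g x"]) auto
qed

text \<open>The generating sets are centred at arbitrary functions. On a compact set a continuous
  error stays below its bound by a positive amount, which leaves room for a neighbourhood centred at
  \<open>f\<close> itself.\<close>

lemma openin_ucc_topology_dmax:
  fixes W :: "('a::metric_space \<times> 'b::metric_space \<Rightarrow> real) set"
  assumes "openin (ucc_topology dmax) W" "f \<in> W"
  shows "\<exists>K e. compact K \<and> e > 0 \<and> {h \<in> cont_funs dmax. \<forall>y\<in>K. \<bar>h y - f y\<bar> < e} \<subseteq> W"
  using assms unfolding ucc_topology_def openin_topology_generated_by_iff mtopology_dmax
proof (induction W arbitrary: f rule: generate_topology_on.induct)
  case Empty
  then show ?case by simp
next
  case (Int a b)
  then have "f \<in> a" "f \<in> b" by auto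
  from Int.IH(1)[OF this(1)] Int.IH(2)[OF this(2)]
  obtain K e K' e' where "compact K" "e > 0" "{h \<in> cont_funs dmax. \<forall>y\<in>K. \<bar>h y - f y\<bar> < e} \<subseteq> a"
    "compact K'" "e' > 0" "{h \<in> cont_funs dmax. \<forall>y\<in>K'. \<bar>h y - f y\<bar> < e'} \<subseteq> b"
    by blast
  then show ?case
    by (intro exI[of _ "K \<union> K'"] exI[of _ "min e e'"]) (auto intro!: compact_Un)
next
  case (UN \<K>)
  then obtain k where "k \<in> \<K>" "f \<in> k" by blast
  from UN.IH[OF this] obtain K e where "compact K" "e > 0"
    "{h \<in> cont_funs dmax. \<forall>y\<in>K. \<bar>h y - f y\<bar> < e} \<subseteq> k"
    by blast
  with \<open>k \<in> \<K>\<close> show ?case by (intro exI[of _ K] exI[of _ e]) auto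
next
  case (Basis s)
  then obtain g K e where s: "s = {f \<in> cont_funs dmax. \<forall>y\<in>K. \<bar>f y - g y\<bar> < e}"
    and g: "g \<in> cont_funs dmax" "compact K" "e > 0"
    by auto
  have "continuous_on K (\<lambda>y. \<bar>f y - g y\<bar>)"
    using g Basis.prems s
    by (auto simp: cont_funs_dmax intro!: continuous_intros intro: continuous_on_subset)
  then obtain d where d: "d > 0" "\<And>y. y \<in> K \<Longrightarrow> \<bar>f y - g y\<bar> + d \<le> e"
    using compact_strict_bound[of K "\<lambda>y. \<bar>f y - g y\<bar>" e] g Basis.prems s by auto
  have "\<bar>h y - g y\<bar> < e" if "y \<in> K" "\<bar>h y - f y\<bar> < d" for h y
    using d(2)[OF that(1)] that(2) by linarith
  then show ?case using g d(1) s by (intro exI[of _ K] exI[of _ d]) auto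
qed

lemma openin_ucc_topology_dmaxI:
  fixes W :: "('a::metric_space \<times> 'b::metric_space \<Rightarrow> real) set"
  assumes W: "W \<subseteq> cont_funs dmax"
    and nhd: "\<And>f. f \<in> W \<Longrightarrow> \<exists>K e. compact K \<and> e > 0 \<and> {h \<in> cont_funs dmax. \<forall>y\<in>K. \<bar>h y - f y\<bar> < e} \<subseteq> W"
  shows "openin (ucc_topology dmax) W"
proof (subst openin_subopen, intro ballI)
  fix f assume f: "f \<in> W"
  obtain K e where K: "compact K" "e > 0" "{h \<in> cont_funs dmax. \<forall>y\<in>K. \<bar>h y - f y\<bar> < e} \<subseteq> W"
    using nhd[OF f] by blast
  have "openin (ucc_topology dmax) {h \<in> cont_funs dmax. \<forall>y\<in>K. \<bar>h y - f y\<bar> < e}"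
    unfolding ucc_topology_def mtopology_dmax
    using K f W
    by (intro topology_generated_by_Basis CollectI exI[of _ f] exI[of _ K] exI[of _ e]) auto
  then show "\<exists>T. openin (ucc_topology dmax) T \<and> f \<in> T \<and> T \<subseteq> W"
    using K f W by (intro exI[of _ "{h \<in> cont_funs dmax. \<forall>y\<in>K. \<bar>h y - f y\<bar> < e}"]) auto
qed

section \<open>Functions modulo constants and closures in the compactification\<close>

lemma mod_const_eq_iff: "mod_const f = mod_const g \<longleftrightarrow> (\<exists>c. \<forall>y. f y = g y + c)"
proof
  assume "mod_const f = mod_const g"
  moreover have "f \<in> mod_const f" by (auto simp: mod_const_def intro: exI[of _ 0])
  ultimately show "\<exists>c. \<forall>y. f y = g y + c" by (auto simp: mod_const_def)
next
  assume "\<exists>c. \<forall>y. f y = g y + c"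
  then obtain c where c: "\<And>y. f y = g y + c" by blast
  have "(\<exists>a. \<forall>y. h y = f y + a) \<longleftrightarrow> (\<exists>a. \<forall>y. h y = g y + a)" for h
    unfolding c by (metis add.assoc diff_add_cancel add.commute)
  then show "mod_const f = mod_const g" by (simp add: mod_const_def)
qed

text \<open>Subtracting the value at \<open>o1\<close> makes the condition invariant under additive
  constants, so the set is a union of classes and its image in the quotient is open.\<close>

lemma openin_Cstar_nhd:
  fixes f :: "'a::metric_space \<times> 'b::metric_space \<Rightarrow> real"
  assumes f: "f \<in> cont_funs dmax" and K: "compact K"
  shows "openin (Cstar dmax)
    (mod_const ` {g \<in> cont_funs dmax. \<forall>y\<in>K. \<bar>(g y - g o1) - (f y - f o1)\<bar> < e})"
    (is "openin _ (_ ` ?N)")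
proof -
  have eq: "{g \<in> cont_funs dmax. mod_const g \<in> mod_const ` ?N} = ?N"
  proof (intro equalityI subsetI)
    fix h assume "h \<in> {g \<in> cont_funs dmax. mod_const g \<in> mod_const ` ?N}"
    then obtain g where g: "h \<in> cont_funs dmax" "g \<in> ?N" "mod_const h = mod_const g" by auto
    then obtain c where "\<And>y. h y = g y + c" unfolding mod_const_eq_iff by blast
    then show "h \<in> ?N" using g by simp
  qed auto
  have "openin (ucc_topology dmax) ?N"
  proof (rule openin_ucc_topology_dmaxI)
    fix g assume g: "g \<in> ?N"
    have "continuous_on K (\<lambda>y. \<bar>(g y - g o1) - (f y - f o1)\<bar>)"
      using g f by (auto simp: cont_funs_dmax intro!: continuous_intros intro: continuous_on_subset)
    then obtain d where d: "d > 0" "\<And>y. y \<in> K \<Longrightarrow> \<bar>(g y - g o1) - (f y - f o1)\<bar> + d \<le> e"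
      using compact_strict_bound[of K "\<lambda>y. \<bar>(g y - g o1) - (f y - f o1)\<bar>" e] g K by auto
    have "\<bar>(h y - h o1) - (f y - f o1)\<bar> < e"
      if "y \<in> K" "\<bar>h y - g y\<bar> < d / 2" "\<bar>h o1 - g o1\<bar> < d / 2" for h y
      using d(2)[OF that(1)] that(2,3) by linarith
    then show "\<exists>K' e'. compact K' \<and> e' > 0 \<and> {h \<in> cont_funs dmax. \<forall>y\<in>K'. \<bar>h y - g y\<bar> < e'} \<subseteq> ?N"
      using d(1) K by (intro exI[of _ "insert o1 K"] exI[of _ "d / 2"]) auto
  qed auto
  then show ?thesis unfolding openin_Cstar eq by auto
qed

lemma horo_embed_dmax_in: "range (horo_embed dmax) \<subseteq> topspace (Cstar dmax)"
  unfolding topspace_Cstar horo_embed_def by (auto simp: cont_funs_dmax continuous_on_dmax)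

text \<open>Normalizing at a point \<open>o1\<close> removes the quotient: closure becomes uniform
  approximation of normalized functions on compact sets.\<close>

lemma closure_of_horo_compactification_dmax:
  fixes U :: "('a::metric_space \<times> 'b::metric_space) set"
  shows "\<eta> \<in> horo_compactification dmax closure_of (horo_embed dmax ` U) \<longleftrightarrow>
    (\<exists>f. continuous_on UNIV f \<and> \<eta> = mod_const f \<and>
      (\<forall>K e. compact K \<longrightarrow> e > 0 \<longrightarrow>
        (\<exists>u\<in>U. \<forall>y\<in>K. \<bar>(dmax u y - dmax u o1) - (f y - f o1)\<bar> < e)))"
    (is "?L \<longleftrightarrow> ?R")
proof -
  define A where "A = horo_embed dmax ` U"
  have A: "A \<subseteq> range (horo_embed dmax)" by (auto simp: A_def)
  then have "A \<subseteq> Cstar dmax closure_of range (horo_embed dmax)"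
    using closure_of_subset[OF horo_embed_dmax_in] by blast
  moreover have "Cstar dmax closure_of A \<subseteq> Cstar dmax closure_of range (horo_embed dmax)"
    using A by (rule closure_of_mono)
  ultimately have "horo_compactification dmax closure_of A = Cstar dmax closure_of A"
    unfolding horo_compactification_def closure_of_subtopology by (simp add: Int_absorb1)
  then have L: "?L \<longleftrightarrow> \<eta> \<in> Cstar dmax closure_of A" by (simp add: A_def)
  have "\<eta> \<in> Cstar dmax closure_of A \<longleftrightarrow> ?R"
  proof
    assume \<eta>: "\<eta> \<in> Cstar dmax closure_of A"
    then obtain f where f: "f \<in> cont_funs dmax" "\<eta> = mod_const f"
      unfolding in_closure_of topspace_Cstar by blast
    have "\<exists>u\<in>U. \<forall>y\<in>K. \<bar>(dmax u y - dmax u o1) - (f y - f o1)\<bar> < e" if K: "compact K" "e > 0" for K e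
    proof -
      let ?N = "{g \<in> cont_funs dmax. \<forall>y\<in>K. \<bar>(g y - g o1) - (f y - f o1)\<bar> < e}"
      have "\<eta> \<in> mod_const ` ?N" using f K by auto
      with \<eta> openin_Cstar_nhd[OF f(1) K(1), of o1 e] obtain a where "a \<in> A" "a \<in> mod_const ` ?N"
        unfolding in_closure_of by meson
      then obtain u where u: "u \<in> U" "horo_embed dmax u \<in> mod_const ` ?N"
        unfolding A_def by blast
      then obtain g where g: "g \<in> ?N" "mod_const (dmax u) = mod_const g"
        by (auto simp: horo_embed_def)
      then obtain c where "\<And>y. dmax u y = g y + c" unfolding mod_const_eq_iff by blast
      then show ?thesis using g u by (intro bexI[of _ u]) auto
    qed
    then show ?R using f by (auto simp: cont_funs_dmax)
  next
    assume ?R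
    then obtain f where f: "continuous_on UNIV f" "\<eta> = mod_const f"
      and approx: "\<And>K e. \<lbrakk>compact K; e > 0\<rbrakk> \<Longrightarrow> \<exists>u\<in>U. \<forall>y\<in>K. \<bar>(dmax u y - dmax u o1) - (f y - f o1)\<bar> < e"
      by blast
    show "\<eta> \<in> Cstar dmax closure_of A"
      unfolding in_closure_of
    proof (intro conjI allI impI)
      show "\<eta> \<in> topspace (Cstar dmax)" using f by (auto simp: topspace_Cstar cont_funs_dmax)
    next
      fix V assume V: "\<eta> \<in> V \<and> openin (Cstar dmax) V"
      then have W: "openin (ucc_topology dmax) {g \<in> cont_funs dmax. mod_const g \<in> V}"
        by (simp add: openin_Cstar)
      have "f \<in> {g \<in> cont_funs dmax. mod_const g \<in> V}"
        using V f by (simp add: cont_funs_dmax)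
      from openin_ucc_topology_dmax[OF W this] obtain K e where K: "compact K" "e > 0"
        "{h \<in> cont_funs dmax. \<forall>y\<in>K. \<bar>h y - f y\<bar> < e} \<subseteq> {g \<in> cont_funs dmax. mod_const g \<in> V}"
        by blast
      obtain u where u: "u \<in> U" "\<And>y. y \<in> K \<Longrightarrow> \<bar>(dmax u y - dmax u o1) - (f y - f o1)\<bar> < e"
        using approx[OF K(1,2)] by blast
      \<comment> \<open>The representative of the class of \<open>u\<close> that agrees with
        \<open>f\<close> at \<open>o1\<close>.\<close>
      define h where "h y = dmax u y + (f o1 - dmax u o1)" for y
      have "h \<in> cont_funs dmax"
        by (auto simp: h_def cont_funs_dmax intro!: continuous_intros continuous_on_dmax)
      moreover have "\<bar>h y - f y\<bar> < e" if "y \<in> K" for y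
        using u(2)[OF that] by (simp add: h_def algebra_simps)
      ultimately have "mod_const h \<in> V" using K(3) by auto
      moreover have "mod_const h = horo_embed dmax u"
        unfolding horo_embed_def mod_const_eq_iff by (auto simp: h_def)
      ultimately show "\<exists>y. y \<in> A \<and> y \<in> V" using u(1) by (auto simp: A_def)
    qed
  qed
  with L show ?thesis by simp
qed


section \<open>Translation length and displacement\<close>

text \<open>Here \<open>len g\<close> stands for the displacement \<open>d(x, g x)\<close> of a base point. Four-point
  hyperbolicity and quasi-convexity of the orbit are expressed through \<open>len\<close> alone, and \<open>prd g h\<close>
  is the Gromov product of \<open>g x\<close> and \<open>h x\<close> at \<open>x\<close>.\<close>

locale hyperbolic_length = group G for G :: "('g, 'm) monoid_scheme" (structure) +
  fixes len :: "'g \<Rightarrow> real" and \<delta> \<epsilon> :: real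
  assumes len_one: "len \<one> = 0"
    and len_inv: "g \<in> carrier G \<Longrightarrow> len (inv g) = len g"
    and len_mult: "\<lbrakk>g \<in> carrier G; h \<in> carrier G\<rbrakk> \<Longrightarrow> len (g \<otimes> h) \<le> len g + len h"
    and four_point: "\<lbrakk>g \<in> carrier G; h \<in> carrier G; k \<in> carrier G\<rbrakk> \<Longrightarrow>
        min (len g + len h - len (inv g \<otimes> h)) (len h + len k - len (inv h \<otimes> k)) - 2 * \<delta>
        \<le> len g + len k - len (inv g \<otimes> k)"
    and midpoint: "g \<in> carrier G \<Longrightarrow>
        \<exists>m\<in>carrier G. \<bar>len m - len g / 2\<bar> \<le> \<epsilon> \<and> \<bar>len (inv m \<otimes> g) - len g / 2\<bar> \<le> \<epsilon>"
    and finite_balls: "finite {g \<in> carrier G. len g \<le> r}"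
    and infinite_group: "infinite (carrier G)"
    and \<delta>_nonneg: "\<delta> \<ge> 0"
begin

definition prd :: "'g \<Rightarrow> 'g \<Rightarrow> real" where
  "prd g h = (len g + len h - len (inv g \<otimes> h)) / 2"

text \<open>The four-point condition as a dichotomy. It serves both to chain two large products and,
  when \<open>prd g k\<close> is small, to keep \<open>h\<close> away from one of \<open>g\<close>
  and \<open>k\<close>.\<close>

lemma prd_trans:
  assumes "g \<in> carrier G" "h \<in> carrier G" "k \<in> carrier G"
  shows "prd g h \<le> prd g k + \<delta> \<or> prd h k \<le> prd g k + \<delta>"
  using four_point[OF assms] unfolding prd_def
  by (auto simp: min_def field_simps split: if_splits)

lemma len_nonneg: "g \<in> carrier G \<Longrightarrow> 0 \<le> len g"
  using len_mult[of g "inv g"] by (simp add: len_inv len_one)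

lemma prd_commute:
  assumes "g \<in> carrier G" "h \<in> carrier G" shows "prd g h = prd h g"
proof -
  have "len (inv g \<otimes> h) = len (inv h \<otimes> g)"
    using assms len_inv[of "inv g \<otimes> h"] by (simp add: inv_mult_group)
  then show ?thesis by (simp add: prd_def)
qed

lemma prd_nonneg: "\<lbrakk>g \<in> carrier G; h \<in> carrier G\<rbrakk> \<Longrightarrow> 0 \<le> prd g h"
  using len_mult[of "inv g" h] by (simp add: prd_def len_inv)

lemma prd_le_len:
  assumes "g \<in> carrier G" "h \<in> carrier G" shows "prd g h \<le> len g"
  using len_mult[of g "inv g \<otimes> h"] assms by (simp add: prd_def m_assoc[symmetric])

lemma prd_le_len': "\<lbrakk>g \<in> carrier G; h \<in> carrier G\<rbrakk> \<Longrightarrow> prd g h \<le> len h"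
  using prd_le_len[of h g] by (simp add: prd_commute)

text \<open>The Gromov products at the two ends of the segment from 1 to \<open>g\<close> add up to
  its length. Translation by \<open>inv g\<close> moves the far end to 1.\<close>

lemma prd_mult:
  assumes "g \<in> carrier G" "h \<in> carrier G"
  shows "prd g (g \<otimes> h) = len g - prd (inv g) h"
  using assms by (simp add: prd_def len_inv m_assoc[symmetric]) (simp add: field_simps)

lemma len_mult_eq:
  assumes "g \<in> carrier G" "h \<in> carrier G"
  shows "len (g \<otimes> h) = len g + len h - 2 * prd (inv g) h"
  using assms by (simp add: prd_def len_inv field_simps)

lemma prd_close:
  assumes "g \<in> carrier G" "h \<in> carrier G"
  shows "prd (g \<otimes> h) g \<ge> len g - len h"
  using len_mult[of "inv h" "inv g"] len_mult[of "g \<otimes> h" "inv h"] assms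
    len_inv[of "inv (g \<otimes> h) \<otimes> g"]
  by (simp add: prd_def len_inv inv_mult_group m_assoc)

lemma prd_translate:
  assumes "f \<in> carrier G" "g \<in> carrier G" "h \<in> carrier G"
  shows "prd (f \<otimes> g) (f \<otimes> h) \<ge> prd g h - len f"
proof -
  have "inv (f \<otimes> g) \<otimes> (f \<otimes> h) = inv g \<otimes> h"
    using assms by (simp add: inv_mult_group m_assoc) (simp add: m_assoc[symmetric])
  moreover have "len g \<le> len f + len (f \<otimes> g)" "len h \<le> len f + len (f \<otimes> h)"
    using len_mult[of "inv f" "f \<otimes> g"] len_mult[of "inv f" "f \<otimes> h"] assms
    by (simp_all add: len_inv m_assoc[symmetric])
  ultimately show ?thesis by (simp add: prd_def field_simps)
qed

text \<open>A local-to-global argument. If a power avoids the direction of \<open>inv g\<close>,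
  then by \<open>prd_mult\<close> one more factor \<open>g\<close> gives a power that follows
  \<open>g\<close> for more than half of its length, and the dichotomy keeps this power away from
  \<open>inv g\<close> again. So each factor adds \<open>len g\<close> up to a fixed loss.\<close>

lemma pow_len_lower:
  assumes g: "g \<in> carrier G" and large: "len g > 2 * prd g (inv g) + 2 * \<delta>"
  shows "prd (inv g) (g [^] Suc n) \<le> prd g (inv g) + \<delta>"
    and "len (g [^] n) \<ge> real n * (len g - 2 * prd g (inv g) - 2 * \<delta>)"
proof -
  show *: "prd (inv g) (g [^] Suc n) \<le> prd g (inv g) + \<delta>" for n
  proof (induction n)
    case 0
    then show ?case using g \<delta>_nonneg by (simp add: prd_commute)
  next
    case (Suc n)
    have "g [^] Suc (Suc n) = g \<otimes> g [^] Suc n"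
      using g nat_pow_Suc2 by blast
    then have "prd g (g [^] Suc (Suc n)) \<ge> len g - prd g (inv g) - \<delta>"
      using Suc g prd_mult[of g "g [^] Suc n"] by simp
    then show ?case
      using prd_trans[of "inv g" "g [^] Suc (Suc n)" g] g large
        prd_commute[of "inv g" g] prd_commute[of "g [^] Suc (Suc n)" g]
      by (auto simp del: nat_pow_Suc)
  qed
  show "len (g [^] n) \<ge> real n * (len g - 2 * prd g (inv g) - 2 * \<delta>)"
  proof (induction n)
    case 0
    then show ?case by (simp add: len_one)
  next
    case (Suc n)
    have eq: "len (g [^] Suc n) = len g + len (g [^] n) - 2 * prd (inv g) (g [^] n)"
      using len_mult_eq[of g "g [^] n"] nat_pow_Suc2[of g n] g by simp
    have "prd (inv g) (g [^] n) \<le> prd g (inv g) + \<delta>"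
    proof (cases n)
      case 0
      then show ?thesis using g prd_le_len'[of "inv g" \<one>] prd_nonneg[of g "inv g"] \<delta>_nonneg
        by (simp add: len_one)
    next
      case (Suc k)
      then show ?thesis using *[of k] by simp
    qed
    then show ?case using Suc eq by (simp add: algebra_simps del: nat_pow_Suc)
  qed
qed

text \<open>Seen from \<open>1\<close>, the inverse of \<open>gf\<close> starts out along \<open>f\<^sup>-\<^sup>1\<close> and \<open>gf\<close> along \<open>g\<close>.\<close>

lemma prd_product_inv:
  assumes "g \<in> carrier G" "f \<in> carrier G"
    and "prd f (inv g) \<le> A" "prd (inv f) g \<le> A"
    and "len g > 2 * A + 2 * \<delta>" "len f > 2 * A + 2 * \<delta>"
  shows "prd (g \<otimes> f) (inv (g \<otimes> f)) \<le> A + 2 * \<delta>"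
proof -
  have "prd g (g \<otimes> f) \<ge> len g - A"
    using assms by (simp add: prd_mult prd_commute)
  moreover have "prd (inv f) (inv f \<otimes> inv g) \<ge> len f - A"
    using assms by (simp add: prd_mult len_inv)
  moreover have "prd g (inv f) \<le> A"
    using assms by (simp add: prd_commute)
  ultimately show ?thesis
    using prd_trans[of g "g \<otimes> f" "inv f"] prd_trans[of "g \<otimes> f" "inv (g \<otimes> f)" "inv f"] assms
      prd_commute[of "inv f \<otimes> inv g" "inv f"] \<delta>_nonneg
    by (auto simp: inv_mult_group)
qed

lemma exists_long: "\<exists>g\<in>carrier G. len g > r"
proof (rule ccontr)
  assume "\<not> ?thesis"
  then have "carrier G = {g \<in> carrier G. len g \<le> r}" by force
  then show False using finite_balls[of r] infinite_group by simp
qed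

lemma \<epsilon>_nonneg: "\<epsilon> \<ge> 0"
  using midpoint[of \<one>] by force

text \<open>Translate a long quasi-geodesic so that its midpoint becomes \<open>1\<close>. Then either one of its
  endpoints, or their product, is a hyperbolic element.\<close>

lemma exists_loxodromic:
  "\<exists>a\<in>carrier G. len a > r \<and> prd a (inv a) \<le> \<epsilon> + 4 * \<delta>"
proof -
  \<comment> \<open>\<open>R\<close> reaches the length threshold of \<open>prd_product_inv\<close>
    for \<open>A = \<epsilon> + 2 * \<delta>\<close>; that lemma returns
    \<open>A + 2 * \<delta>\<close>, which is the bound claimed.\<close>
  define R where "R = max r 0 + 2 * (\<epsilon> + 2 * \<delta>) + 2 * \<delta>"
  obtain g where g: "g \<in> carrier G" "len g > 2 * (R + \<epsilon>)" using exists_long by blast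
  obtain m where m: "m \<in> carrier G" "\<bar>len m - len g / 2\<bar> \<le> \<epsilon>"
    "\<bar>len (inv m \<otimes> g) - len g / 2\<bar> \<le> \<epsilon>"
    using midpoint[OF g(1)] by blast
  define u v where "u = inv m" and "v = inv m \<otimes> g"
  have uv: "u \<in> carrier G" "v \<in> carrier G" using m g by (auto simp: u_def v_def)
  have "inv u \<otimes> v = g" using m g by (simp add: u_def v_def m_assoc[symmetric])
  then have uv0: "prd u v \<le> \<epsilon>" using m by (simp add: prd_def u_def v_def len_inv abs_le_iff)
  have long: "len u > R" "len v > R" using m g by (auto simp: u_def v_def len_inv abs_le_iff)
  have Rr: "R \<ge> r" using \<delta>_nonneg \<epsilon>_nonneg by (simp add: R_def)
  show ?thesis
  proof (cases "prd u (inv u) \<le> \<epsilon> + 4 * \<delta> \<or> prd v (inv v) \<le> \<epsilon> + 4 * \<delta>")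
    case True
    then show ?thesis using uv long Rr by force
  next
    case False
    then have F: "prd u (inv u) > \<epsilon> + 4 * \<delta>" "prd v (inv v) > \<epsilon> + 4 * \<delta>" by auto
    \<comment> \<open>If \<open>u\<close> and \<open>inv u\<close> point the same way,
      \<open>inv u\<close> diverges from \<open>v\<close> because \<open>u\<close> does; likewise
      for \<open>inv v\<close> and \<open>u\<close>. So there is little cancellation in
      \<open>u \<otimes> v\<close>.\<close>
    have a: "prd (inv u) v \<le> \<epsilon> + \<delta>"
      using prd_trans[of u "inv u" v] F uv uv0 \<delta>_nonneg by auto
    have b: "prd u (inv v) \<le> \<epsilon> + \<delta>"
      using prd_trans[of u "inv v" v] F uv uv0 \<delta>_nonneg prd_commute[of v "inv v"] by auto
    have "prd (u \<otimes> v) (inv (u \<otimes> v)) \<le> (\<epsilon> + 2 * \<delta>) + 2 * \<delta>"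
      using uv a b long \<delta>_nonneg prd_commute[of v "inv u"] prd_commute[of "inv v" u]
      by (intro prd_product_inv) (auto simp: R_def)
    moreover have "len (u \<otimes> v) > r"
      using len_mult_eq[OF uv] a long \<delta>_nonneg \<epsilon>_nonneg by (simp add: R_def)
    ultimately show ?thesis using uv by force
  qed
qed

section \<open>Powers of a hyperbolic element and elements commuting with them\<close>

lemma prd_pow_self:
  assumes g: "g \<in> carrier G" and large: "len g > 2 * prd g (inv g) + 2 * \<delta>"
  shows "prd g (g [^] Suc n) \<ge> len g - prd g (inv g) - \<delta>"
proof -
  have "prd (inv g) (g [^] n) \<le> prd g (inv g) + \<delta>"
  proof (cases n)
    case 0
    then show ?thesis using g prd_le_len'[of "inv g" \<one>] prd_nonneg[of g "inv g"] \<delta>_nonneg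
      by (simp add: len_one)
  next
    case (Suc k)
    then show ?thesis using pow_len_lower(1)[OF assms, of k] by simp
  qed
  then show ?thesis using g prd_mult[of g "g [^] n"] nat_pow_Suc2[of g n] by simp
qed

lemma prd_inv_pow_self:
  assumes g: "g \<in> carrier G" and large: "len g > 2 * prd g (inv g) + 2 * \<delta>"
  shows "prd (inv g) (inv (g [^] Suc n)) \<ge> len g - prd g (inv g) - \<delta>"
  using prd_pow_self[of "inv g" n] g large
  unfolding nat_pow_inv[OF g] by (simp add: len_inv prd_commute del: nat_pow_Suc)

text \<open>\<open>a [^] n\<close> avoids \<open>inv a\<close>, whereas its inverse follows
  \<open>inv a\<close>. The bound is independent of \<open>n\<close>, so arbitrarily long powers may
  be used below.\<close>

lemma prd_pow_inv_pow:
  assumes a: "a \<in> carrier G" and large: "len a > 2 * prd a (inv a) + 6 * \<delta>" "n > (0::nat)"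
  shows "prd (a [^] n) (inv (a [^] n)) \<le> prd a (inv a) + 2 * \<delta>"
proof -
  obtain k where k: "n = Suc k" using large(2) by (cases n) auto
  have "len a > 2 * prd a (inv a) + 2 * \<delta>" using large \<delta>_nonneg by simp
  note * = pow_len_lower(1)[OF a this, of k] prd_inv_pow_self[OF a this, of k]
  show ?thesis
    using prd_trans[of "inv a" "inv (a [^] n)" "a [^] n"] * a large prd_commute \<delta>_nonneg
    unfolding k by (auto simp del: nat_pow_Suc)
qed

text \<open>The element \<open>P \<otimes> inv f = inv f \<otimes> P\<close> starts along
  \<open>inv f\<close>, because \<open>f\<close> diverges from \<open>P\<close>, and it stays close
  to \<open>P\<close>, because it ends near \<open>P\<close>. Hence \<open>inv f\<close> points
  towards \<open>P\<close> while \<open>f\<close> does not, unless \<open>f\<close> is so short that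
  the bound is trivial.\<close>

lemma prd_inv_le_if_commutes:
  assumes "f \<in> carrier G" "P \<in> carrier G" "f \<otimes> P = P \<otimes> f"
    and "prd f P \<le> B" "len P \<ge> 2 * len f"
  shows "prd f (inv f) \<le> 2 * B + 2 * \<delta>"
proof -
  have B: "B \<ge> 0" using prd_nonneg[of f P] assms by simp
  have "inv f \<otimes> P = P \<otimes> inv f"
    using assms by (metis inv_closed inv_solve_left' inv_solve_right m_assoc m_closed)
  then have 1: "prd (inv f) (P \<otimes> inv f) \<ge> len f - B"
    using prd_mult[of "inv f" P] assms by (simp add: len_inv)
  have 2: "prd (P \<otimes> inv f) P \<ge> len f"
    using prd_close[of P "inv f"] assms by (simp add: len_inv)
  have 3: "prd (inv f) P \<ge> len f - B - \<delta>"
    using prd_trans[of "inv f" "P \<otimes> inv f" P] 1 2 assms B by auto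
  show ?thesis
    using prd_trans[of f "inv f" P] 3 prd_le_len[of f "inv f"] assms B \<delta>_nonneg by auto
qed

text \<open>A long power \<open>P\<close> and its inverse diverge, so \<open>f\<close> diverges from
  one of them, and it commutes with both. The bound depends on \<open>a\<close> alone, although
  \<open>j\<close> may depend on \<open>f\<close>.\<close>

lemma prd_inv_le_if_commutes_pow:
  assumes a: "a \<in> carrier G" and large: "len a > 2 * prd a (inv a) + 6 * \<delta>"
    and f: "f \<in> carrier G" and j: "j > (0::nat)" "f \<otimes> a [^] j = a [^] j \<otimes> f"
  shows "prd f (inv f) \<le> 2 * prd a (inv a) + 8 * \<delta>"
proof -
  define c where "c = len a - 2 * prd a (inv a) - 2 * \<delta>"
  have l2: "len a > 2 * prd a (inv a) + 2 * \<delta>" using large \<delta>_nonneg by simp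
  then have "c > 0" by (simp add: c_def)
  then obtain k where k: "2 * len f + 1 < real k * c" using reals_Archimedean3 by blast
  have k0: "k > 0" using k len_nonneg[OF f] by (cases k) auto
  define P where "P = a [^] (j * k)"
  have P: "P \<in> carrier G" using a by (simp add: P_def)
  have "k \<le> j * k" using j by simp
  then have "real k * c \<le> real (j * k) * c"
    using \<open>c > 0\<close> by (intro mult_right_mono) (simp_all del: of_nat_mult)
  then have len: "len P \<ge> 2 * len f"
    using pow_len_lower(2)[OF a l2, of "j * k"] k unfolding P_def c_def by simp
  have PI: "prd P (inv P) \<le> prd a (inv a) + 2 * \<delta>"
    unfolding P_def using prd_pow_inv_pow[OF a large] j k0 by simp
  have "P = (a [^] j) [^] k" using a by (simp add: P_def nat_pow_pow)
  then have com: "f \<otimes> P = P \<otimes> f"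
    using group_commutes_pow[of "a [^] j" f k] j a f by simp
  then have com': "f \<otimes> inv P = inv P \<otimes> f"
    using P f by (metis inv_closed inv_solve_left' inv_solve_right m_assoc m_closed)
  have "prd f P \<le> prd a (inv a) + 3 * \<delta> \<or> prd f (inv P) \<le> prd a (inv a) + 3 * \<delta>"
    using prd_trans[of P f "inv P"] PI P f prd_commute[of P f] by auto
  then show ?thesis
    using prd_inv_le_if_commutes[OF f P com _ len] P com' len
      prd_inv_le_if_commutes[OF f, of "inv P"] by (force simp: len_inv)
qed

text \<open>Pigeonhole: the conjugates lie in a finite ball, so two of them coincide, and
  \<open>j\<close> is the difference of the exponents.\<close>

lemma commutes_pow_if_bounded_conjugates:
  assumes a: "a \<in> carrier G" and f: "f \<in> carrier G"
    and C: "\<And>n :: nat. len (inv (a [^] n) \<otimes> (f \<otimes> a [^] n)) \<le> C"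
  obtains j :: nat where "j > 0" "f \<otimes> a [^] j = a [^] j \<otimes> f"
proof -
  define \<phi> where "\<phi> n = inv (a [^] n) \<otimes> (f \<otimes> a [^] n)" for n :: nat
  have "range \<phi> \<subseteq> {g \<in> carrier G. len g \<le> C}"
    using C a f by (auto simp: \<phi>_def)
  then have "finite (range \<phi>)" using finite_balls finite_subset by blast
  then have "\<not> inj \<phi>" using finite_imageD infinite_UNIV_nat by blast
  then obtain m n where mn: "m < n" "\<phi> m = \<phi> n"
    unfolding inj_def by (metis linorder_neqE_nat)
  define j where "j = n - m"
  have cl: "a [^] m \<in> carrier G" "a [^] j \<in> carrier G" using a by auto
  have n: "a [^] n = a [^] j \<otimes> a [^] m"
    using mn a by (simp add: j_def nat_pow_mult)
  have "inv (a [^] m) \<otimes> (f \<otimes> a [^] m) = inv (a [^] m) \<otimes> ((inv (a [^] j) \<otimes> f \<otimes> a [^] j) \<otimes> a [^] m)"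
    using mn(2) cl f unfolding \<phi>_def n by (simp add: inv_mult_group m_assoc)
  then have "f = inv (a [^] j) \<otimes> f \<otimes> a [^] j"
    using cl f by simp
  then have "a [^] j \<otimes> f = f \<otimes> a [^] j"
    using cl f by (metis inv_closed inv_solve_left m_assoc m_closed)
  then show ?thesis using mn by (intro that[of j]) (auto simp: j_def)
qed

text \<open>The hypothesis on \<open>g\<close> says that every element of the group almost fixes a boundary point,
  which is the attracting fixed point of \<open>a\<close>. Hence \<open>f a\<^sup>n\<close> stays close to \<open>a\<^sup>n\<close>.\<close>

lemma bounded_conjugates_if_fixed_end:
  assumes a: "a \<in> carrier G" and large: "len a > 2 * prd a (inv a) + 6 * \<delta>"
    and f: "f \<in> carrier G"
    and fixed: "\<And>F K. \<lbrakk>finite F; F \<subseteq> carrier G\<rbrakk> \<Longrightarrow>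
       \<exists>g\<in>carrier G. (\<forall>f\<in>F. prd g (f \<otimes> g) > K) \<and> prd (inv a) g \<le> A"
    and A: "A \<ge> 0" "len a > prd a (inv a) + A + 2 * \<delta>"
  shows "len (inv (a [^] (n::nat)) \<otimes> (f \<otimes> a [^] n)) \<le> 3 * len f + 2 * A + 8 * \<delta>"
proof (cases n)
  case 0
  then show ?thesis using f len_nonneg[OF f] A \<delta>_nonneg by simp
next
  case (Suc k)
  define P where "P = a [^] n"
  have P: "P \<in> carrier G" using a by (simp add: P_def)
  have l2: "len a > 2 * prd a (inv a) + 2 * \<delta>" using large \<delta>_nonneg by simp
  \<comment> \<open>\<open>g\<close> stands for the fixed boundary point: as far as distance
    \<open>len P\<close>, neither \<open>f\<close> nor \<open>P\<close> moves it, and it is not the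
    repelling end of \<open>a\<close>.\<close>
  obtain g where g: "g \<in> carrier G" "prd g (f \<otimes> g) > len P" "prd g (P \<otimes> g) > len P" "prd (inv a) g \<le> A"
    using fixed[of "{f, P}" "len P"] f P by auto
  have "prd (inv P) g \<le> A + \<delta>"
    using prd_trans[of "inv a" "inv P" g] prd_inv_pow_self[OF a l2, of k] g a P A
    unfolding P_def Suc by (auto simp del: nat_pow_Suc)
  then have "prd P (P \<otimes> g) \<ge> len P - A - \<delta>"
    using P g by (simp add: prd_mult)
  then have 1: "prd P g \<ge> len P - A - 2 * \<delta>"
    using prd_trans[of P "P \<otimes> g" g] P g A \<delta>_nonneg prd_commute[of g "P \<otimes> g"] by auto
  then have "prd (f \<otimes> P) (f \<otimes> g) \<ge> len P - A - 2 * \<delta> - len f"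
    using prd_translate[OF f P g(1)] by simp
  then have "prd (f \<otimes> P) g \<ge> len P - A - 3 * \<delta> - len f"
    using prd_trans[of "f \<otimes> P" "f \<otimes> g" g] P g f A \<delta>_nonneg prd_commute[of g "f \<otimes> g"]
      len_nonneg[OF f] by auto
  then have "prd (f \<otimes> P) P \<ge> len P - A - 4 * \<delta> - len f"
    using prd_trans[of "f \<otimes> P" g P] 1 P g f A \<delta>_nonneg prd_commute[of g P]
      len_nonneg[OF f] by auto
  then have "prd P (f \<otimes> P) \<ge> len P - A - 4 * \<delta> - len f"
    using P f prd_commute by simp
  moreover have "len (f \<otimes> P) \<le> len f + len P" using len_mult f P by simp
  ultimately show ?thesis unfolding P_def[symmetric] by (simp add: prd_def)
qed

text \<open>If no finite set worked, elements \<open>g\<close> with \<open>gf\<close> and its inverse close to each other at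
  infinity for all \<open>f\<close> would converge to a boundary point fixed by the whole group, and so would
  their inverses. Then a power of a hyperbolic element is centralized by any given element, which
  forces inverse elements to be far apart at infinity.\<close>

lemma exists_finite_corrector:
  "\<exists>F K. finite F \<and> F \<subseteq> carrier G \<and>
     (\<forall>g\<in>carrier G. \<exists>f\<in>F. prd (g \<otimes> f) (inv (g \<otimes> f)) \<le> K)"
proof (rule ccontr)
  assume neg: "\<not> ?thesis"
  have fixed: "\<exists>g\<in>carrier G. prd g (inv g) > K \<and> (\<forall>f\<in>F. prd g (f \<otimes> g) > K)"
    if F: "finite F" "F \<subseteq> carrier G" for F K
  proof -
    define M where "M = sum len F"
    have M: "len f \<le> M" if "f \<in> F" for f
      unfolding M_def using F that len_nonneg by (intro member_le_sum) auto
    have M0: "M \<ge> 0" unfolding M_def using F len_nonneg by (intro sum_nonneg) auto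
    define K' where "K' = K + M + 2 * \<delta>"
    have "finite (insert \<one> (m_inv G ` F))" "insert \<one> (m_inv G ` F) \<subseteq> carrier G"
      using F by auto
    then obtain g where g: "g \<in> carrier G"
      and gf: "\<And>f. f \<in> insert \<one> (m_inv G ` F) \<Longrightarrow> prd (g \<otimes> f) (inv (g \<otimes> f)) > K'"
      using neg by (meson not_le)
    have gi: "prd g (inv g) > K'" using gf[of \<one>] g by simp
    then have len: "len g > K'" using prd_le_len[of g "inv g"] g by simp
    \<comment> \<open>The chain is \<open>g\<close>, \<open>g \<otimes> inv f\<close>, the inverse
      \<open>f \<otimes> inv g\<close> of the latter, and \<open>f \<otimes> g\<close>. Its links
      lose at most \<open>M\<close> and the two dichotomies \<open>2 * \<delta>\<close>, which
      explains \<open>K'\<close>.\<close>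
    have "prd g (f \<otimes> g) > K" if "f \<in> F" for f
    proof -
      have f: "f \<in> carrier G" using F that by auto
      have 1: "prd g (g \<otimes> inv f) > K' - M"
        using prd_close[of g "inv f"] f g M[OF that] len prd_commute[of g "g \<otimes> inv f"]
        by (simp add: len_inv)
      have 2: "prd (g \<otimes> inv f) (f \<otimes> inv g) > K'"
        using gf[of "inv f"] that f g by (simp add: inv_mult_group)
      have 3: "prd (f \<otimes> inv g) (f \<otimes> g) > K' - M"
        using prd_translate[of f "inv g" g] f g M[OF that] gi prd_commute[of g "inv g"] by simp
      have "prd (g \<otimes> inv f) (f \<otimes> g) > K' - M - \<delta>"
        using prd_trans[of "g \<otimes> inv f" "f \<otimes> inv g" "f \<otimes> g"] 2 3 f g M0 by auto
      then show ?thesis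
        using prd_trans[of g "g \<otimes> inv f" "f \<otimes> g"] 1 f g \<delta>_nonneg by (auto simp: K'_def)
    qed
    then show ?thesis using g gi M0 \<delta>_nonneg by (intro bexI[of _ g]) (auto simp: K'_def)
  qed
  define A0 where "A0 = \<epsilon> + 4 * \<delta>"
  obtain a where a: "a \<in> carrier G" "len a > 2 * A0 + 6 * \<delta>" "prd a (inv a) \<le> A0"
    using exists_loxodromic[of "2 * A0 + 6 * \<delta>"] unfolding A0_def by blast
  have A0: "A0 \<ge> 0" using prd_nonneg[of a "inv a"] a by simp
  \<comment> \<open>The elements \<open>g\<close> cannot follow both ends of \<open>a\<close>. If
    \<open>Q\<close> failed for \<open>a\<close> and for \<open>inv a\<close>, a \<open>g\<close>
    taken for the union of the two sets and the maximum of the two constants would do so. Hence one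
    \<open>b\<close> serves all \<open>F\<close> and \<open>K\<close>.\<close>
  define Q where "Q b \<longleftrightarrow> (\<forall>F K. finite F \<longrightarrow> F \<subseteq> carrier G \<longrightarrow>
       (\<exists>g\<in>carrier G. (\<forall>f\<in>F. prd g (f \<otimes> g) > K) \<and> prd (inv b) g \<le> A0 + \<delta>))" for b
  have "Q a \<or> Q (inv a)"
  proof (rule ccontr)
    assume "\<not> ?thesis"
    then obtain F1 K1 F2 K2
      where 1: "finite F1" "F1 \<subseteq> carrier G"
        "\<And>g. \<lbrakk>g \<in> carrier G; \<And>f. f \<in> F1 \<Longrightarrow> prd g (f \<otimes> g) > K1\<rbrakk> \<Longrightarrow> prd (inv a) g > A0 + \<delta>"
        and 2: "finite F2" "F2 \<subseteq> carrier G"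
        "\<And>g. \<lbrakk>g \<in> carrier G; \<And>f. f \<in> F2 \<Longrightarrow> prd g (f \<otimes> g) > K2\<rbrakk> \<Longrightarrow> prd a g > A0 + \<delta>"
      unfolding Q_def using a by (simp add: not_le) (metis not_le)
    obtain g where g: "g \<in> carrier G" "\<And>f. f \<in> F1 \<union> F2 \<Longrightarrow> prd g (f \<otimes> g) > max K1 K2"
      using fixed[of "F1 \<union> F2" "max K1 K2"] 1 2 by auto
    then have "prd (inv a) g > A0 + \<delta>" "prd a g > A0 + \<delta>"
      by (auto intro!: 1 2)
    then show False
      using prd_trans[of "inv a" g a] a g prd_commute[of a "inv a"] prd_commute[of a g] by auto
  qed
  then obtain b where b: "b \<in> carrier G" "len b > 2 * A0 + 6 * \<delta>" "prd b (inv b) \<le> A0" "Q b"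
    using a that[of a] that[of "inv a"] by (auto simp: len_inv prd_commute)
  then have large: "len b > 2 * prd b (inv b) + 6 * \<delta>" by simp
  have "prd f (inv f) \<le> 2 * A0 + 8 * \<delta>" if f: "f \<in> carrier G" for f
  proof -
    have "len (inv (b [^] n) \<otimes> (f \<otimes> b [^] n)) \<le> 3 * len f + 2 * (A0 + \<delta>) + 8 * \<delta>" for n :: nat
      using b A0 \<delta>_nonneg \<open>Q b\<close>
      by (intro bounded_conjugates_if_fixed_end[OF b(1) large f]) (auto simp: Q_def)
    then obtain j :: nat where "j > 0" "f \<otimes> b [^] j = b [^] j \<otimes> f"
      using commutes_pow_if_bounded_conjugates[OF b(1) f] by metis
    then show ?thesis
      using prd_inv_le_if_commutes_pow[OF b(1) large f, of j] b(3) by linarith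
  qed
  \<comment> \<open>Even for empty \<open>F\<close>, \<open>fixed\<close> provides an element that
    follows its own inverse beyond the uniform bound.\<close>
  then show False using fixed[of "{}" "2 * A0 + 8 * \<delta>"] by force
qed

lemma stable_length_lower:
  assumes g: "g \<in> carrier G" and lim: "(\<lambda>n. len (g [^] n) / real n) \<longlonglongrightarrow> l"
  shows "len g - 2 * prd g (inv g) - 2 * \<delta> \<le> l"
proof (cases "len g > 2 * prd g (inv g) + 2 * \<delta>")
  case True
  show ?thesis
  proof (rule LIMSEQ_le_const[OF lim], intro exI allI impI)
    fix n :: nat assume "n \<ge> 1"
    then show "len g - 2 * prd g (inv g) - 2 * \<delta> \<le> len (g [^] n) / real n"
      using pow_len_lower(2)[OF g True, of n] by (simp add: field_simps)
  qed
next
  case False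
  have "0 \<le> l"
    by (rule LIMSEQ_le_const[OF lim]) (use g len_nonneg in auto)
  then show ?thesis using False by simp
qed

text \<open>The corrector bounds the loss in \<open>stable_length_lower\<close> for
  \<open>g \<otimes> f\<close>, and \<open>sum len F\<close> bounds every \<open>len f\<close>.
  Since convergence is not among the assumptions of the locale, the limit \<open>l\<close> is
  quantified.\<close>

lemma stable_length_corrected:
  "\<exists>F K. finite F \<and> F \<subseteq> carrier G \<and>
     (\<forall>g\<in>carrier G. \<exists>f\<in>F. \<forall>l. (\<lambda>n. len ((g \<otimes> f) [^] n) / real n) \<longlonglongrightarrow> l \<longrightarrow> len g \<le> l + K)"
proof -
  obtain F K where F: "finite F" "F \<subseteq> carrier G"
    and K: "\<And>g. g \<in> carrier G \<Longrightarrow> \<exists>f\<in>F. prd (g \<otimes> f) (inv (g \<otimes> f)) \<le> K"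
    using exists_finite_corrector by blast
  have "\<exists>f\<in>F. \<forall>l. (\<lambda>n. len ((g \<otimes> f) [^] n) / real n) \<longlonglongrightarrow> l \<longrightarrow> len g \<le> l + (2 * K + 2 * \<delta> + sum len F)"
    if g: "g \<in> carrier G" for g
  proof -
    obtain f where f: "f \<in> F" "prd (g \<otimes> f) (inv (g \<otimes> f)) \<le> K" using K[OF g] by blast
    have fG: "f \<in> carrier G" using f F by auto
    have "len f \<le> sum len F" using F f len_nonneg by (intro member_le_sum) auto
    moreover have "len g \<le> len (g \<otimes> f) + len f"
      using len_mult[of "g \<otimes> f" "inv f"] g fG by (simp add: len_inv m_assoc)
    ultimately show ?thesis
      using f stable_length_lower[of "g \<otimes> f"] g fG by (intro bexI[of _ f]) force+
  qed
  then show ?thesis using F by blast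
qed

end

section \<open>Subadditive sequences and translation length\<close>

lemma fekete:
  fixes a :: "nat \<Rightarrow> real"
  assumes sub: "\<And>m n. a (m + n) \<le> a m + a n" and nonneg: "\<And>n. a n \<ge> 0" and a0: "a 0 = 0"
  obtains l where "(\<lambda>n. a n / real n) \<longlonglongrightarrow> l" "l \<le> a 1"
proof -
  have mult: "a (q * m) \<le> real q * a m" for q m
  proof (induction q)
    case (Suc q)
    then show ?case using sub[of m "q * m"] by (simp add: algebra_simps)
  qed (simp add: a0)
  define l where "l = Inf ((\<lambda>n. a n / real n) ` {1..})"
  have bdd: "bdd_below ((\<lambda>n. a n / real n) ` {1..})"
    using nonneg by (intro bdd_belowI2[of _ 0]) auto
  have lower: "l \<le> a n / real n" if "n \<ge> 1" for n
    unfolding l_def using that bdd by (intro cInf_lower) auto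
  have "(\<lambda>n. a n / real n) \<longlonglongrightarrow> l"
  proof (rule order_tendstoI)
    fix u assume u: "u < l"
    show "\<forall>\<^sub>F n in sequentially. u < a n / real n"
      using eventually_ge_at_top[of 1] by eventually_elim (use u lower in force)
  next
    fix u assume "l < u"
    then obtain m where m: "m \<ge> 1" "a m / real m < u"
      using cInf_lessD[of "(\<lambda>n. a n / real n) ` {1..}" u] unfolding l_def by auto
    have "(\<lambda>n. a m / real m + real m * a 1 / real n) \<longlonglongrightarrow> a m / real m + 0"
      by (intro tendsto_add tendsto_const lim_const_over_n)
    then have "\<forall>\<^sub>F n in sequentially. a m / real m + real m * a 1 / real n < u"
      using m(2) by (intro order_tendstoD(2)) auto
    then show "\<forall>\<^sub>F n in sequentially. a n / real n < u"
      using eventually_ge_at_top[of 1]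
    proof eventually_elim
      case (elim n)
      define q r where "q = n div m" and "r = n mod m"
      have n: "n = q * m + r" "r < m" using m by (auto simp: q_def r_def)
      have "a n \<le> real q * a m + real r * a 1"
        using sub[of "q * m" r] mult[of q m] mult[of r 1] by (simp add: n(1)[symmetric])
      also have "\<dots> \<le> real n * (a m / real m) + real m * a 1"
      proof (rule add_mono)
        have "real q * a m = real (q * m) * (a m / real m)" using m by simp
        also have "\<dots> \<le> real n * (a m / real m)"
          using n(1) nonneg by (intro mult_right_mono) (simp_all del: of_nat_mult)
        finally show "real q * a m \<le> real n * (a m / real m)" .
        show "real r * a 1 \<le> real m * a 1" using n(2) nonneg by (intro mult_right_mono) auto
      qed
      finally have "a n / real n \<le> a m / real m + real m * a 1 / real n"
        using elim(2) by (simp add: field_simps)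
      then show ?case using elim(1) by linarith
    qed
  qed
  then show ?thesis using that lower[of 1] by simp
qed

text \<open>The definition by \<open>THE\<close> asks for one limit at all points. Changing the
  point alters the displacement of a power by at most \<open>2 * dist x y\<close>, which disappears
  after division by \<open>n\<close>.\<close>

lemma translation_length_tendsto:
  fixes f :: "'a::metric_space \<Rightarrow> 'a"
  assumes iso: "\<And>x y. dist (f x) (f y) = dist x y"
  shows "(\<lambda>n. dist x ((f ^^ n) x) / real n) \<longlonglongrightarrow> translation_length f"
    and "translation_length f \<le> dist x (f x)"
proof -
  have isop: "dist ((f ^^ n) x) ((f ^^ n) y) = dist x y" for n x y
    by (induction n) (auto simp: iso)
  have lim: "\<exists>l. (\<lambda>n. dist x ((f ^^ n) x) / real n) \<longlonglongrightarrow> l \<and> l \<le> dist x (f x)" for x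
  proof -
    have "dist x ((f ^^ (m + n)) x) \<le> dist x ((f ^^ m) x) + dist x ((f ^^ n) x)" for m n
      using dist_triangle[of x "(f ^^ (m + n)) x" "(f ^^ m) x"] isop[of m x "(f ^^ n) x"]
      by (simp add: funpow_add)
    then show ?thesis by (rule fekete[of "\<lambda>n. dist x ((f ^^ n) x)"]) auto
  qed
  obtain l where l: "(\<lambda>n. dist x ((f ^^ n) x) / real n) \<longlonglongrightarrow> l" using lim by blast
  have all: "(\<lambda>n. dist y ((f ^^ n) y) / real n) \<longlonglongrightarrow> l" for y
  proof -
    have "(\<lambda>n. dist y ((f ^^ n) y) / real n - dist x ((f ^^ n) x) / real n) \<longlonglongrightarrow> 0"
    proof (rule Lim_null_comparison)
      show "(\<lambda>n. 2 * dist x y / real n) \<longlonglongrightarrow> 0" by (rule lim_const_over_n)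
      have "\<bar>dist y ((f ^^ n) y) - dist x ((f ^^ n) x)\<bar> \<le> 2 * dist x y" for n
        using isop[of n x y] dist_triangle[of y "(f ^^ n) y" x] dist_triangle[of x "(f ^^ n) y" "(f ^^ n) x"]
          dist_triangle[of x "(f ^^ n) x" y] dist_triangle[of y "(f ^^ n) x" "(f ^^ n) y"]
        by (simp add: dist_commute abs_le_iff)
      then have "norm (dist y ((f ^^ n) y) / real n - dist x ((f ^^ n) x) / real n) \<le> 2 * dist x y / real n" for n
        by (simp add: diff_divide_distrib[symmetric] divide_right_mono)
      then show "\<forall>\<^sub>F n in sequentially.
          norm (dist y ((f ^^ n) y) / real n - dist x ((f ^^ n) x) / real n) \<le> 2 * dist x y / real n"
        by simp
    qed
    from tendsto_add[OF this l] show ?thesis by simp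
  qed
  have "translation_length f = l"
    unfolding translation_length_def by (rule the_equality) (use all LIMSEQ_unique in blast)+
  then show "(\<lambda>n. dist x ((f ^^ n) x) / real n) \<longlonglongrightarrow> translation_length f" using all by simp
  then show "translation_length f \<le> dist x (f x)" using lim[of x] LIMSEQ_unique by blast
qed

section \<open>Isometric actions with quasi-convex orbits\<close>

locale isometric_action = group G for G :: "('g, 'm) monoid_scheme" (structure) +
  fixes \<rho> :: "'g \<Rightarrow> 'a::metric_space \<Rightarrow> 'a"
  assumes hom: "\<rho> \<in> hom G isometry_group"
begin

lemma dist_act: "g \<in> carrier G \<Longrightarrow> dist (\<rho> g x) (\<rho> g y) = dist x y"
  using hom by (auto simp: hom_def isometry_group_def)

lemma act_mult: "\<lbrakk>g \<in> carrier G; h \<in> carrier G\<rbrakk> \<Longrightarrow> \<rho> (g \<otimes> h) x = \<rho> g (\<rho> h x)"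
  using hom by (auto simp: hom_def isometry_group_def)

lemma act_one: "\<rho> \<one> x = x"
  using dist_act[of \<one> "\<rho> \<one> x" x] act_mult[of \<one> \<one> x] by simp

lemma act_inv: "g \<in> carrier G \<Longrightarrow> \<rho> g (\<rho> (inv g) x) = x"
  using act_mult[of g "inv g" x] by (simp add: act_one)

lemma dist_act_inv:
  "\<lbrakk>g \<in> carrier G; h \<in> carrier G\<rbrakk> \<Longrightarrow> dist (\<rho> g x) (\<rho> h y) = dist x (\<rho> (inv g \<otimes> h) y)"
  using dist_act[of g x "\<rho> (inv g) (\<rho> h y)"] by (simp add: act_inv act_mult)

lemma act_pow: "g \<in> carrier G \<Longrightarrow> \<rho> (g [^] (n::nat)) x = (\<rho> g ^^ n) x"
proof (induction n)
  case (Suc n)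
  then show ?case using nat_pow_Suc2[of g n] by (simp add: act_mult)
qed (simp add: act_one)

lemma dist_act_mult_le:
  assumes "g \<in> carrier G" "h \<in> carrier G"
  shows "dist x (\<rho> (g \<otimes> h) x) \<le> dist x (\<rho> g x) + dist x (\<rho> h x)"
  using dist_triangle[of x "\<rho> (g \<otimes> h) x" "\<rho> g x"] dist_act[of g x "\<rho> h x"] assms
  by (simp add: act_mult)

lemma stable_length:
  assumes "g \<in> carrier G"
  shows "(\<lambda>n. dist x (\<rho> (g [^] n) x) / real n) \<longlonglongrightarrow> translation_length (\<rho> g)"
    and "translation_length (\<rho> g) \<le> dist x (\<rho> g x)"
  using translation_length_tendsto[of "\<rho> g" x] dist_act assms by (simp_all add: act_pow)

text \<open>Proper discontinuity leaves finitely many isometries, and the group elements inducing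
  one of them form a coset of the finite kernel.\<close>

lemma finite_orbit_balls:
  assumes proper: "proper_space TYPE('a)" and qc: "quasi_convex_rep G \<rho>"
  shows "finite {g \<in> carrier G. dist x (\<rho> g x) \<le> r}"
proof -
  define B where "B = {g \<in> carrier G. dist x (\<rho> g x) \<le> r}"
  define N where "N = kernel G isometry_group \<rho>"
  have N: "finite N" using qc by (simp add: quasi_convex_rep_def N_def)
  have "compact (cball x \<bar>r\<bar>)" using proper unfolding proper_space_def by blast
  then have "finite {h \<in> \<rho> ` carrier G. h ` cball x \<bar>r\<bar> \<inter> cball x \<bar>r\<bar> \<noteq> {}}"
    using qc by (simp add: quasi_convex_rep_def quasi_convex_group_def properly_discontinuous_def)
  moreover have "\<rho> ` B \<subseteq> {h \<in> \<rho> ` carrier G. h ` cball x \<bar>r\<bar> \<inter> cball x \<bar>r\<bar> \<noteq> {}}"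
  proof
    fix h assume "h \<in> \<rho> ` B"
    then obtain g where "g \<in> carrier G" "dist x (\<rho> g x) \<le> r" "h = \<rho> g" by (auto simp: B_def)
    moreover then have "h x \<in> h ` cball x \<bar>r\<bar> \<inter> cball x \<bar>r\<bar>" by auto
    ultimately show "h \<in> {h \<in> \<rho> ` carrier G. h ` cball x \<bar>r\<bar> \<inter> cball x \<bar>r\<bar> \<noteq> {}}" by blast
  qed
  ultimately have fin: "finite (\<rho> ` B)" by (rule finite_subset[rotated])
  have "B \<subseteq> (\<Union>h\<in>\<rho> ` B. (\<otimes>) (SOME g. g \<in> B \<and> \<rho> g = h) ` N)"
  proof
    fix g assume g: "g \<in> B"
    define k where "k = (SOME k. k \<in> B \<and> \<rho> k = \<rho> g)"
    have k: "k \<in> B" "\<rho> k = \<rho> g"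
      unfolding k_def using someI[of "\<lambda>k. k \<in> B \<and> \<rho> k = \<rho> g" g] g by auto
    have kg: "k \<in> carrier G" "g \<in> carrier G" using k g by (auto simp: B_def)
    have "\<rho> (inv k \<otimes> g) x = x" for x
      using kg k(2) act_mult[of "inv k" g x] act_mult[of "inv k" k x] by (simp add: act_one)
    then have "inv k \<otimes> g \<in> N"
      using kg by (auto simp: N_def kernel_def isometry_group_def)
    moreover have "g = k \<otimes> (inv k \<otimes> g)" using kg by (simp add: m_assoc[symmetric])
    ultimately show "g \<in> (\<Union>h\<in>\<rho> ` B. (\<otimes>) (SOME g. g \<in> B \<and> \<rho> g = h) ` N)"
      using g unfolding k_def by blast
  qed
  then show ?thesis unfolding B_def[symmetric]
    by (rule finite_subset) (intro finite_UN_I fin finite_imageI N)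
qed

text \<open>Quasi-convexity is applied at the midpoint of a segment between orbit points: an orbit
  point nearby gives the element that \<open>midpoint\<close> asks for. The constant
  \<open>2 * ln 2\<close> is that of the four-point condition.\<close>

lemma hyperbolic_length:
  assumes CAT: "CAT_neg1 TYPE('a)" and proper: "proper_space TYPE('a)"
    and qc: "quasi_convex_rep G \<rho>" and inf: "infinite (carrier G)"
  obtains \<epsilon> where "hyperbolic_length G (\<lambda>g. dist x (\<rho> g x)) (2 * ln 2) \<epsilon>"
proof -
  have "quasi_convex_set ((\<lambda>h. h x) ` \<rho> ` carrier G)"
    using qc by (simp add: quasi_convex_rep_def quasi_convex_group_def)
  then obtain \<epsilon> where \<epsilon>: "\<And>y z c t. \<lbrakk>y \<in> (\<lambda>h. h x) ` \<rho> ` carrier G; z \<in> (\<lambda>h. h x) ` \<rho> ` carrier G;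
      geodesic UNIV dist c y z; t \<in> {0..dist y z}\<rbrakk>
      \<Longrightarrow> \<exists>w\<in>(\<lambda>h. h x) ` \<rho> ` carrier G. dist (c t) w \<le> \<epsilon>"
    unfolding quasi_convex_set_def by metis
  have "hyperbolic_length G (\<lambda>g. dist x (\<rho> g x)) (2 * ln 2) \<epsilon>"
  proof (unfold_locales, goal_cases)
    case 1
    show ?case by (simp add: act_one)
  next
    case (2 g)
    then show ?case using dist_act_inv[of g \<one> x x] by (simp add: act_one dist_commute)
  next
    case (3 g h)
    then show ?case by (rule dist_act_mult_le)
  next
    case (4 g h k)
    have eq: "gromov_product dist x (\<rho> u x) (\<rho> v x)
        = (dist x (\<rho> u x) + dist x (\<rho> v x) - dist x (\<rho> (inv u \<otimes> v) x)) / 2"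
      if "u \<in> carrier G" "v \<in> carrier G" for u v
      using that by (simp add: gromov_product_def dist_act_inv[symmetric] dist_commute)
    then show ?case
      using CAT_neg1_four_point[OF CAT, of x "\<rho> g x" "\<rho> h x" "\<rho> k x"]
      unfolding eq[OF 4(1,2)] eq[OF 4(2,3)] eq[OF 4(1,3)]
      by (simp add: min_def field_simps split: if_splits)
  next
    case (5 g)
    define L where "L = dist x (\<rho> g x)"
    obtain c where c: "geodesic UNIV dist c x (\<rho> g x)" using CAT unfolding CAT_neg1_def by blast
    have "x = \<rho> \<one> x" by (simp add: act_one)
    then have "x \<in> (\<lambda>h. h x) ` \<rho> ` carrier G" by blast
    then obtain m where m: "m \<in> carrier G" "dist (c (L / 2)) (\<rho> m x) \<le> \<epsilon>"
      using \<epsilon>[OF _ _ c, of "L / 2"] 5 by (auto simp: L_def)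
    have "dist x (c (L / 2)) = L / 2" "dist (c (L / 2)) (\<rho> g x) = L / 2"
      using geodesicD(4,5)[OF c, of "L / 2"] by (simp_all add: L_def)
    then have "\<bar>dist x (\<rho> m x) - L / 2\<bar> \<le> \<epsilon>" "\<bar>dist (\<rho> m x) (\<rho> g x) - L / 2\<bar> \<le> \<epsilon>"
      using m(2) dist_triangle[of x "\<rho> m x" "c (L / 2)"] dist_triangle[of x "c (L / 2)" "\<rho> m x"]
        dist_triangle[of "\<rho> m x" "\<rho> g x" "c (L / 2)"] dist_triangle[of "c (L / 2)" "\<rho> g x" "\<rho> m x"]
      by (simp_all add: abs_le_iff dist_commute)
    then show ?case using m(1) 5 by (auto simp: L_def dist_act_inv)
  next
    case (6 r)
    show ?case by (rule finite_orbit_balls[OF proper qc])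
  next
    case 7
    show ?case by (rule inf)
  next
    case 8
    show ?case by simp
  qed
  then show ?thesis by (rule that)
qed

end

text \<open>\<open>len g\<close> is controlled by \<open>\<tau> (g \<otimes> f)\<close>, hence by
  \<open>len2 (g \<otimes> f)\<close>, and \<open>f\<close> comes from a finite set, so it is
  removed at a bounded cost in \<open>len2\<close>.\<close>

lemma (in hyperbolic_length) len_le_if_stable_length_le:
  assumes len2: "\<And>g h. \<lbrakk>g \<in> carrier G; h \<in> carrier G\<rbrakk> \<Longrightarrow> len2 (g \<otimes> h) \<le> len2 g + len2 h"
    and nonneg: "\<And>g. g \<in> carrier G \<Longrightarrow> (0::real) \<le> len2 g"
    and lim: "\<And>g. g \<in> carrier G \<Longrightarrow> (\<lambda>n. len (g [^] n) / real n) \<longlonglongrightarrow> \<tau> g"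
    and \<tau>: "\<And>g. g \<in> carrier G \<Longrightarrow> \<tau> g \<le> len2 g"
  shows "\<exists>C. \<forall>g\<in>carrier G. len g \<le> len2 g + C"
proof -
  obtain F K where F: "finite F" "F \<subseteq> carrier G"
    and K: "\<And>g. g \<in> carrier G \<Longrightarrow>
      \<exists>f\<in>F. \<forall>l. (\<lambda>n. len ((g \<otimes> f) [^] n) / real n) \<longlonglongrightarrow> l \<longrightarrow> len g \<le> l + K"
    using stable_length_corrected by blast
  have "len g \<le> len2 g + (sum len2 F + K)" if g: "g \<in> carrier G" for g
  proof -
    obtain f where f: "f \<in> F" "len g \<le> \<tau> (g \<otimes> f) + K"
      using K[OF g] F lim g by (meson m_closed subsetD)
    have fG: "f \<in> carrier G" using f F by auto
    have "len2 f \<le> sum len2 F" using F f nonneg by (intro member_le_sum) auto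
    then show ?thesis
      using f(2) \<tau>[of "g \<otimes> f"] len2[OF g fG] g fG by simp
  qed
  then show ?thesis by blast
qed

text \<open>Moving a base point changes displacements by at most twice the distance moved, and left
  translation reduces two group elements to one. Base points can thus be chosen at will.\<close>

lemma coarsely_equivalent_iff:
  fixes \<rho>1 :: "'g \<Rightarrow> 'a::metric_space \<Rightarrow> 'a" and \<rho>2 :: "'g \<Rightarrow> 'b::metric_space \<Rightarrow> 'b"
  assumes "isometric_action G \<rho>1" "isometric_action G \<rho>2"
  shows "coarsely_equivalent G \<rho>1 \<rho>2 \<longleftrightarrow>
    (\<exists>C. \<forall>g\<in>carrier G. \<bar>dist x (\<rho>1 g x) - dist y (\<rho>2 g y)\<bar> \<le> C)"
proof -
  interpret A: isometric_action G \<rho>1 by fact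
  interpret B: isometric_action G \<rho>2 by fact
  show ?thesis
  proof
    assume "coarsely_equivalent G \<rho>1 \<rho>2"
    then obtain C p q where C: "\<And>g h. \<lbrakk>g \<in> carrier G; h \<in> carrier G\<rbrakk> \<Longrightarrow>
        \<bar>dist (\<rho>1 g p) (\<rho>1 h p) - dist (\<rho>2 g q) (\<rho>2 h q)\<bar> \<le> C"
      unfolding coarsely_equivalent_def by blast
    have "\<bar>dist x (\<rho>1 g x) - dist y (\<rho>2 g y)\<bar> \<le> C + 2 * dist x p + 2 * dist y q"
      if g: "g \<in> carrier G" for g
      using C[OF A.one_closed g] A.dist_act[OF g, of x p] B.dist_act[OF g, of y q]
        dist_triangle[of x "\<rho>1 g x" p] dist_triangle[of p "\<rho>1 g x" "\<rho>1 g p"]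
        dist_triangle[of p "\<rho>1 g p" x] dist_triangle[of x "\<rho>1 g p" "\<rho>1 g x"]
        dist_triangle[of y "\<rho>2 g y" q] dist_triangle[of q "\<rho>2 g y" "\<rho>2 g q"]
        dist_triangle[of q "\<rho>2 g q" y] dist_triangle[of y "\<rho>2 g q" "\<rho>2 g y"]
      by (simp add: A.act_one B.act_one dist_commute abs_le_iff)
    then show "\<exists>C. \<forall>g\<in>carrier G. \<bar>dist x (\<rho>1 g x) - dist y (\<rho>2 g y)\<bar> \<le> C" by blast
  next
    assume "\<exists>C. \<forall>g\<in>carrier G. \<bar>dist x (\<rho>1 g x) - dist y (\<rho>2 g y)\<bar> \<le> C"
    then obtain C where C: "\<And>g. g \<in> carrier G \<Longrightarrow> \<bar>dist x (\<rho>1 g x) - dist y (\<rho>2 g y)\<bar> \<le> C" by blast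
    \<comment> \<open>The definition requires a positive constant, hence \<open>+ 1\<close>.\<close>
    have "\<bar>dist (\<rho>1 g x) (\<rho>1 h x) - dist (\<rho>2 g y) (\<rho>2 h y)\<bar> \<le> \<bar>C\<bar> + 1"
      if "g \<in> carrier G" "h \<in> carrier G" for g h
      using C[of "inv\<^bsub>G\<^esub> g \<otimes>\<^bsub>G\<^esub> h"] that by (simp add: A.dist_act_inv B.dist_act_inv)
    then show "coarsely_equivalent G \<rho>1 \<rho>2"
      unfolding coarsely_equivalent_def
      by (intro exI[of _ "\<bar>C\<bar> + 1"] conjI exI[of _ x] exI[of _ y]) auto
  qed
qed


section \<open>Horofunctions of the product\<close>

lemma dmax_diff_le: "\<bar>dmax u x - dmax u y\<bar> \<le> dist x y"
proof -
  interpret Metric_space UNIV "dmax :: 'a \<times> 'b \<Rightarrow> _" by (rule Metric_space_dmax)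
  show ?thesis
    using triangle[of u y x] triangle[of u x y] commute[of x y] dmax_le_dist[of x y] by simp
qed

text \<open>Distance functions are 1-Lipschitz, so pointwise convergence is locally uniform.\<close>

lemma closure_of_horo_embed_if_pointwise:
  fixes h :: "'a::metric_space \<times> 'b::metric_space \<Rightarrow> real"
  assumes u: "\<And>n. u n \<in> U" and lim: "\<And>y. (\<lambda>n. dmax (u n) y - dmax (u n) o1) \<longlonglongrightarrow> h y"
  shows "mod_const h \<in> horo_compactification dmax closure_of (horo_embed dmax ` U)"
proof -
  define F where "F n y = dmax (u n) y - dmax (u n) o1" for n y
  have limF: "(\<lambda>n. F n y) \<longlonglongrightarrow> h y" for y using lim by (simp add: F_def)
  have lip: "\<bar>F n x - F n y\<bar> \<le> dist x y" for n x y
    using dmax_diff_le[of "u n" x y] by (simp add: F_def)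
  have liph: "\<bar>h x - h y\<bar> \<le> dist x y" for x y
    by (rule LIMSEQ_le_const2[OF tendsto_rabs[OF tendsto_diff[OF limF limF]]]) (use lip in auto)
  have "h o1 = 0"
    using LIMSEQ_unique[OF limF[of o1]] by (simp add: F_def)
  have "continuous_on UNIV h"
    unfolding continuous_on_iff dist_real_def using liph by (meson le_less_trans)
  moreover have "\<exists>n. \<forall>y\<in>K. \<bar>F n y - h y\<bar> < e" if K: "compact K" "e > 0" for K e
  proof -
    have "e / 3 > 0" using K by simp
    then obtain k where k: "finite k" "K \<subseteq> (\<Union>x\<in>k. ball x (e / 3))"
      using K(1) unfolding compact_eq_totally_bounded by blast
    have "\<forall>\<^sub>F n in sequentially. \<bar>F n x - h x\<bar> < e / 3" for x
      using tendstoD[OF limF[of x] \<open>e / 3 > 0\<close>] by (simp add: dist_real_def)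
    then have "\<forall>\<^sub>F n in sequentially. \<forall>x\<in>k. \<bar>F n x - h x\<bar> < e / 3"
      using k(1) by (simp add: eventually_ball_finite)
    then obtain n where n: "\<And>x. x \<in> k \<Longrightarrow> \<bar>F n x - h x\<bar> < e / 3"
      using eventually_happens trivial_limit_sequentially by blast
    have "\<bar>F n y - h y\<bar> < e" if "y \<in> K" for y
    proof -
      obtain x where "x \<in> k" "dist x y < e / 3" using k(2) \<open>y \<in> K\<close> by auto
      then show ?thesis using n[of x] lip[of n x y] liph[of x y] by linarith
    qed
    then show ?thesis by blast
  qed
  ultimately show ?thesis
    unfolding closure_of_horo_compactification_dmax[of _ _ o1]
    using u \<open>h o1 = 0\<close> unfolding F_def by (intro exI[of _ h]) fastforce
qed

text \<open>Once the difference of the displacements exceeds \<open>dist p z + dist p' z'\<close>,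
  the first factor realizes the maximum in \<open>dmax\<close> at \<open>(z, z')\<close> as well as
  at \<open>(p, p')\<close>.\<close>

lemma horofunction_seq_first_factor:
  fixes p :: "'a::metric_space" and p' :: "'b::metric_space"
  assumes CAT: "CAT_neg1 TYPE('a)" and proper: "proper_space TYPE('a)"
    and diff: "filterlim (\<lambda>n. dist p (a n) - dist p' (b n)) at_top sequentially"
  obtains \<xi> r where "\<xi> \<in> visual_boundary" "strict_mono (r :: nat \<Rightarrow> nat)"
    "\<And>z z'. (\<lambda>n. dmax (a (r n), b (r n)) (z, z') - dmax (a (r n), b (r n)) (p, p'))
       \<longlonglongrightarrow> busemann p \<xi> z"
proof -
  have "filterlim (\<lambda>n. dist p (a n)) at_top sequentially"
    by (rule filterlim_at_top_mono[OF diff]) simp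
  then obtain \<xi> r where \<xi>: "\<xi> \<in> visual_boundary" and r: "strict_mono (r :: nat \<Rightarrow> nat)"
    and lim: "\<And>z. (\<lambda>n. dist (a (r n)) z - dist (a (r n)) p) \<longlonglongrightarrow> busemann p \<xi> z"
    using exists_busemann_limit[OF CAT proper] by metis
  have large: "\<forall>\<^sub>F n in sequentially. t \<le> dist p (a (r n)) - dist p' (b (r n))" for t
    using filterlim_compose[OF diff filterlim_subseq[OF r]] by (simp add: filterlim_at_top)
  have "(\<lambda>n. dmax (a (r n), b (r n)) (z, z') - dmax (a (r n), b (r n)) (p, p'))
       \<longlonglongrightarrow> busemann p \<xi> z" for z z'
  proof (rule Lim_transform_eventually[OF lim])
    show "\<forall>\<^sub>F n in sequentially. dist (a (r n)) z - dist (a (r n)) p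
        = dmax (a (r n), b (r n)) (z, z') - dmax (a (r n), b (r n)) (p, p')"
      using large[of 0] large[of "dist p z + dist p' z'"]
    proof eventually_elim
      case (elim n)
      have "dist (a (r n)) z \<ge> dist (b (r n)) z'"
        using elim(2) dist_triangle[of p "a (r n)" z] dist_triangle[of "b (r n)" z' p']
        by (simp add: dist_commute)
      then show ?case using elim(1) by (simp add: dmax_def dist_commute max_def)
    qed
  qed
  then show ?thesis using that \<xi> r by blast
qed

lemma dmax_swap: "dmax u v = dmax (prod.swap u) (prod.swap v)"
  by (simp add: dmax_def max.commute)

lemma strict_mono_compose:
  "strict_mono (r :: nat \<Rightarrow> nat) \<Longrightarrow> strict_mono (s :: nat \<Rightarrow> nat) \<Longrightarrow> strict_mono (\<lambda>n. r (s n))"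
  by (simp add: strict_mono_def)

text \<open>If displacements stay bounded along a subsequence, the points accumulate in the product
  and the limit is a distance function, which \<open>ideal\<close> excludes. Otherwise both
  displacements tend to infinity, and successive subsequences make the two Busemann limits and the
  difference of displacements converge; the limit of this difference is the constant of the regular
  form.\<close>

lemma horofunction_seq_both_factors:
  fixes p :: "'a::metric_space" and p' :: "'b::metric_space"
  assumes CAT: "CAT_neg1 TYPE('a)" "CAT_neg1 TYPE('b)"
    and proper: "proper_space TYPE('a)" "proper_space TYPE('b)"
    and diff: "\<And>n. \<bar>dist p (a n) - dist p' (b n)\<bar> \<le> C"
    and lim: "\<And>y. (\<lambda>n. dmax (a n, b n) y - dmax (a n, b n) (p, p')) \<longlonglongrightarrow> f y - f (p, p')"
    and ideal: "mod_const f \<notin> range (horo_embed dmax)"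
  shows "\<exists>\<xi>\<in>visual_boundary. \<exists>\<xi>'\<in>visual_boundary. \<exists>C::real.
          mod_const f = mod_const (\<lambda>(z, z'). max (busemann p \<xi> z) (busemann p' \<xi>' z' - C))"
proof (cases "filterlim (\<lambda>n. dist p (a n)) at_top sequentially")
  case False
  then obtain R where "\<exists>\<^sub>F n in sequentially. dist p (a n) < R"
    by (auto simp: filterlim_at_top not_eventually not_le)
  then have "infinite {n. dist p (a n) < R}"
    by (simp add: frequently_cofinite[symmetric] cofinite_eq_sequentially)
  then obtain r :: "nat \<Rightarrow> nat" where r: "strict_mono r" "\<And>n. r n \<in> {n. dist p (a n) < R}"
    using infinite_enumerate by blast
  have in_K: "(a (r n), b (r n)) \<in> cball p R \<times> cball p' (R + C)" for n
    using r(2)[of n] diff[of "r n"] by auto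
  have "compact (cball p R \<times> cball p' (R + C))"
    using proper unfolding proper_space_def by (blast intro: compact_Times)
  from this[unfolded compact_def, rule_format, of "\<lambda>n. (a (r n), b (r n))", OF in_K]
  obtain l s where s: "strict_mono (s :: nat \<Rightarrow> nat)" "((\<lambda>n. (a (r n), b (r n))) \<circ> s) \<longlonglongrightarrow> l"
    by blast
  have "f y - f (p, p') = dmax l y - dmax l (p, p')" for y
  proof (rule LIMSEQ_unique)
    show "(\<lambda>n. dmax (a (r (s n)), b (r (s n))) y - dmax (a (r (s n)), b (r (s n))) (p, p'))
        \<longlonglongrightarrow> f y - f (p, p')"
      using LIMSEQ_subseq_LIMSEQ[OF lim strict_mono_compose[OF r(1) s(1)]] by (simp add: o_def)
    have "(\<lambda>n. (a (r (s n)), b (r (s n)))) \<longlonglongrightarrow> l" using s(2) by (simp add: o_def)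
    then show "(\<lambda>n. dmax (a (r (s n)), b (r (s n))) y - dmax (a (r (s n)), b (r (s n))) (p, p'))
        \<longlonglongrightarrow> dmax l y - dmax l (p, p')"
      unfolding dmax_def by (intro tendsto_intros)
  qed
  then have "f y = dmax l y + (f (p, p') - dmax l (p, p'))" for y
    by (metis add.commute add_diff_eq diff_add_cancel)
  then have "mod_const f = horo_embed dmax l"
    unfolding horo_embed_def mod_const_eq_iff by blast
  then show ?thesis using ideal by blast
next
  case inf: True
  obtain \<xi> r where \<xi>: "\<xi> \<in> visual_boundary" and r: "strict_mono (r :: nat \<Rightarrow> nat)"
    and lim_a: "\<And>z. (\<lambda>n. dist (a (r n)) z - dist (a (r n)) p) \<longlonglongrightarrow> busemann p \<xi> z"
    using exists_busemann_limit[OF CAT(1) proper(1) inf] by metis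
  have "- C + dist p (a n) \<le> dist p' (b n)" for n
    using diff[of n] by (simp add: abs_le_iff)
  moreover have "filterlim (\<lambda>n. - C + dist p (a (r n))) at_top sequentially"
    by (intro filterlim_tendsto_add_at_top[OF tendsto_const]
        filterlim_compose[OF inf filterlim_subseq[OF r]])
  ultimately have "filterlim (\<lambda>n. dist p' (b (r n))) at_top sequentially"
    by (auto intro: filterlim_at_top_mono)
  then obtain \<xi>' s where \<xi>': "\<xi>' \<in> visual_boundary" and s: "strict_mono (s :: nat \<Rightarrow> nat)"
    and lim_b: "\<And>z. (\<lambda>n. dist (b (r (s n))) z - dist (b (r (s n))) p') \<longlonglongrightarrow> busemann p' \<xi>' z"
    by (rule exists_busemann_limit[OF CAT(2) proper(2)]) (rule that)
  have "dist p (a (r (s n))) - dist p' (b (r (s n))) \<in> cball 0 C" for n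
    using diff by simp
  from compact_cball[of "0 :: real" C, unfolded compact_def, rule_format,
      of "\<lambda>n. dist p (a (r (s n))) - dist p' (b (r (s n)))", OF this]
  obtain D t where t: "strict_mono (t :: nat \<Rightarrow> nat)"
    and lim_D: "((\<lambda>n. dist p (a (r (s n))) - dist p' (b (r (s n)))) \<circ> t) \<longlonglongrightarrow> D"
    by blast
  define k where "k n = r (s (t n))" for n
  have k: "strict_mono k" unfolding k_def using r s t by (simp add: strict_mono_def)
  have 1: "(\<lambda>n. dist (a (k n)) z - dist (a (k n)) p) \<longlonglongrightarrow> busemann p \<xi> z" for z
    using LIMSEQ_subseq_LIMSEQ[OF lim_a strict_mono_compose[OF s t]] by (simp add: o_def k_def)
  have 2: "(\<lambda>n. dist (b (k n)) z - dist (b (k n)) p') \<longlonglongrightarrow> busemann p' \<xi>' z" for z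
    using LIMSEQ_subseq_LIMSEQ[OF lim_b t] by (simp add: o_def k_def)
  have 3: "(\<lambda>n. dist (a (k n)) p - dist (b (k n)) p') \<longlonglongrightarrow> D"
    using lim_D by (simp add: o_def k_def dist_commute)
  have "f (z, z') - f (p, p') = max (busemann p \<xi> z) (busemann p' \<xi>' z' - D) - max 0 (0 - D)" for z z'
  proof (rule LIMSEQ_unique)
    show "(\<lambda>n. dmax (a (k n), b (k n)) (z, z') - dmax (a (k n), b (k n)) (p, p'))
        \<longlonglongrightarrow> f (z, z') - f (p, p')"
      using LIMSEQ_subseq_LIMSEQ[OF lim k] by (simp add: o_def)
    \<comment> \<open>\<open>dist (a (k n)) p\<close> is subtracted from all entries of the two
      maxima, so that only convergent quantities remain.\<close>
    have "(\<lambda>n. max (dist (a (k n)) z - dist (a (k n)) p)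
              (dist (b (k n)) z' - dist (b (k n)) p' - (dist (a (k n)) p - dist (b (k n)) p'))
            - max 0 (0 - (dist (a (k n)) p - dist (b (k n)) p')))
        \<longlonglongrightarrow> max (busemann p \<xi> z) (busemann p' \<xi>' z' - D) - max 0 (0 - D)"
      by (intro tendsto_intros 1 2 3)
    moreover have "max (dist (a (k n)) z - dist (a (k n)) p)
              (dist (b (k n)) z' - dist (b (k n)) p' - (dist (a (k n)) p - dist (b (k n)) p'))
            - max 0 (0 - (dist (a (k n)) p - dist (b (k n)) p'))
        = dmax (a (k n), b (k n)) (z, z') - dmax (a (k n), b (k n)) (p, p')" for n
      by (simp add: dmax_def max_def)
    ultimately show "(\<lambda>n. dmax (a (k n), b (k n)) (z, z') - dmax (a (k n), b (k n)) (p, p'))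
        \<longlonglongrightarrow> max (busemann p \<xi> z) (busemann p' \<xi>' z' - D) - max 0 (0 - D)"
      by simp
  qed
  then have "f y = (\<lambda>(z, z'). max (busemann p \<xi> z) (busemann p' \<xi>' z' - D)) y
      + (f (p, p') - max 0 (0 - D))" for y
    by (cases y) (simp add: algebra_simps)
  then have "mod_const f = mod_const (\<lambda>(z, z'). max (busemann p \<xi> z) (busemann p' \<xi>' z' - D))"
    unfolding mod_const_eq_iff by blast
  then show ?thesis using \<xi> \<xi>' by blast
qed

text \<open>Along a ray towards \<open>\<xi>\<close> the second term of the maximum dominates, and vice versa, so a
  regular horofunction depends on both variables.\<close>

lemma regular_depends_on_both:
  fixes \<xi> :: "(real \<Rightarrow> 'a::metric_space) set" and \<xi>' :: "(real \<Rightarrow> 'b::metric_space) set"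
  assumes CAT: "CAT_neg1 TYPE('a)" "CAT_neg1 TYPE('b)"
    and proper: "proper_space TYPE('a)" "proper_space TYPE('b)"
    and \<xi>: "\<xi> \<in> visual_boundary" "\<xi>' \<in> visual_boundary"
    and eq: "mod_const f = mod_const (\<lambda>(z, z'). max (busemann p \<xi> z) (busemann p' \<xi>' z' - C))"
  shows "\<exists>z z1 z2. f (z, z1) \<noteq> f (z, z2)" "\<exists>z z1 z2. f (z1, z) \<noteq> f (z2, z)"
proof -
  obtain c where c: "\<And>z z'. f (z, z') = max (busemann p \<xi> z) (busemann p' \<xi>' z' - C) + c"
    using eq unfolding mod_const_eq_iff by auto
  \<comment> \<open>The value \<open>- (\<bar>C\<bar> + 1)\<close> keeps one entry of the maximum
    below or equal to the other at both test points, whatever the sign of \<open>C\<close>.\<close>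
  obtain x0 x1 xC where x: "busemann p \<xi> x0 = - 0" "busemann p \<xi> x1 = - 1" "busemann p \<xi> xC = - (\<bar>C\<bar> + 1)"
    using busemann_attains[OF CAT(1) proper(1) \<xi>(1), of _ p] by (metis abs_ge_zero add_nonneg_nonneg order_refl zero_le_one)
  obtain y0 y1 yC where y: "busemann p' \<xi>' y0 = - 0" "busemann p' \<xi>' y1 = - 1" "busemann p' \<xi>' yC = - (\<bar>C\<bar> + 1)"
    using busemann_attains[OF CAT(2) proper(2) \<xi>(2), of _ p'] by (metis abs_ge_zero add_nonneg_nonneg order_refl zero_le_one)
  have "f (xC, y0) \<noteq> f (xC, y1)" unfolding c x y by (auto simp: max_def)
  then show "\<exists>z z1 z2. f (z, z1) \<noteq> f (z, z2)" by blast
  have "f (x0, yC) \<noteq> f (x1, yC)" unfolding c x y by (auto simp: max_def)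
  then show "\<exists>z z1 z2. f (z1, z) \<noteq> f (z2, z)" by blast
qed

lemma not_horo_embed_if_unbounded:
  assumes "\<And>s. s \<ge> 0 \<Longrightarrow> \<exists>y. f y = - s"
  shows "mod_const f \<notin> range (horo_embed dmax)"
proof
  assume "mod_const f \<in> range (horo_embed dmax)"
  then obtain u c where c: "\<And>y. f y = dmax u y + c"
    unfolding horo_embed_def image_iff mod_const_eq_iff by blast
  obtain y where "f y = - (\<bar>c\<bar> + 1)" using assms[of "\<bar>c\<bar> + 1"] by auto
  moreover have "dmax u y \<ge> 0" by (simp add: dmax_def le_max_iff_disj)
  ultimately show False using c[of y] by linarith
qed

section \<open>The large limit set and its regularity\<close>

lemma horo_compactification_point_in_large_limit_set:
  assumes "\<eta> \<in> horo_compactification dmax closure_of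
      (horo_embed dmax ` {(\<rho>1 g x, \<rho>2 g y) | g. g \<in> carrier G})"
    and "\<eta> \<notin> range (horo_embed dmax)"
  shows "\<eta> \<in> large_limit_set G \<rho>1 \<rho>2"
proof -
  have "horo_embed dmax ` {(\<rho>1 g x, \<rho>2 g y) | g. g \<in> carrier G}
      = {horo_embed dmax (\<rho>1 g x, \<rho>2 g y) | g. g \<in> carrier G}"
    by auto
  moreover have "\<eta> \<in> ideal_boundary dmax"
    using assms closure_of_subset_topspace by (fastforce simp: ideal_boundary_def)
  ultimately show ?thesis
    using assms(1) unfolding large_limit_set_def by auto
qed

lemma large_limit_setE:
  assumes "\<eta> \<in> large_limit_set G \<rho>1 \<rho>2"
  obtains x y where "\<eta> \<in> horo_compactification dmax closure_of
      (horo_embed dmax ` {(\<rho>1 g x, \<rho>2 g y) | g. g \<in> carrier G})"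
    "\<eta> \<in> ideal_boundary dmax"
proof -
  have "horo_embed dmax ` {(\<rho>1 g x, \<rho>2 g y) | g. g \<in> carrier G}
      = {horo_embed dmax (\<rho>1 g x, \<rho>2 g y) | g. g \<in> carrier G}" for x y
    by auto
  then show ?thesis using assms that unfolding large_limit_set_def by auto
qed

lemma large_limit_set_regular_if_coarsely_equivalent:
  fixes p :: "'a::metric_space" and p' :: "'b::metric_space"
  assumes CAT: "CAT_neg1 TYPE('a)" "CAT_neg1 TYPE('b)"
    and proper: "proper_space TYPE('a)" "proper_space TYPE('b)"
    and act: "isometric_action G \<rho>1" "isometric_action G \<rho>2"
    and coarse: "coarsely_equivalent G \<rho>1 \<rho>2"
  shows "large_limit_set G \<rho>1 \<rho>2 \<subseteq> ideal_boundary_reg p p'"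
proof
  fix \<eta> assume \<eta>: "\<eta> \<in> large_limit_set G \<rho>1 \<rho>2"
  obtain x y where closure: "\<eta> \<in> horo_compactification dmax closure_of
      (horo_embed dmax ` {(\<rho>1 g x, \<rho>2 g y) | g. g \<in> carrier G})"
    and ideal: "\<eta> \<in> ideal_boundary dmax"
    using \<eta> by (rule large_limit_setE)
  obtain f where f: "\<eta> = mod_const f"
    and approx: "\<And>K e. \<lbrakk>compact K; e > 0\<rbrakk> \<Longrightarrow>
      \<exists>u\<in>{(\<rho>1 g x, \<rho>2 g y) | g. g \<in> carrier G}. \<forall>v\<in>K.
         \<bar>(dmax u v - dmax u (p, p')) - (f v - f (p, p'))\<bar> < e"
    using closure unfolding closure_of_horo_compactification_dmax[of _ _ "(p, p')"] by blast
  \<comment> \<open>A sequence is extracted from the closure: products of balls of radius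
    \<open>n\<close> exhaust the product, and the error allowed on them tends to 0.\<close>
  have "\<exists>g. g \<in> carrier G \<and> (\<forall>v\<in>cball p (real n) \<times> cball p' (real n).
      \<bar>(dmax (\<rho>1 g x, \<rho>2 g y) v - dmax (\<rho>1 g x, \<rho>2 g y) (p, p')) - (f v - f (p, p'))\<bar> < inverse (real (Suc n)))"
    for n
  proof -
    have "compact (cball p (real n) \<times> cball p' (real n))"
      using proper unfolding proper_space_def by (blast intro: compact_Times)
    from approx[OF this, of "inverse (real (Suc n))"] show ?thesis by auto
  qed
  then obtain g where g: "\<And>n. g n \<in> carrier G"
    and near: "\<And>n v. v \<in> cball p (real n) \<times> cball p' (real n) \<Longrightarrow>
      \<bar>(dmax (\<rho>1 (g n) x, \<rho>2 (g n) y) v - dmax (\<rho>1 (g n) x, \<rho>2 (g n) y) (p, p')) - (f v - f (p, p'))\<bar>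
        < inverse (real (Suc n))"
    by metis
  obtain C where C: "\<And>g. g \<in> carrier G \<Longrightarrow> \<bar>dist x (\<rho>1 g x) - dist y (\<rho>2 g y)\<bar> \<le> C"
    using coarse unfolding coarsely_equivalent_iff[OF act, of x y] by blast
  have diff: "\<bar>dist p (\<rho>1 (g n) x) - dist p' (\<rho>2 (g n) y)\<bar> \<le> C + dist p x + dist p' y" for n
    using C[OF g[of n]] dist_triangle[of p "\<rho>1 (g n) x" x] dist_triangle[of x "\<rho>1 (g n) x" p]
      dist_triangle[of p' "\<rho>2 (g n) y" y] dist_triangle[of y "\<rho>2 (g n) y" p']
    by (simp add: dist_commute abs_le_iff)
  have lim: "(\<lambda>n. dmax (\<rho>1 (g n) x, \<rho>2 (g n) y) v - dmax (\<rho>1 (g n) x, \<rho>2 (g n) y) (p, p'))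
      \<longlonglongrightarrow> f v - f (p, p')" for v
  proof (rule LIM_zero_cancel, rule Lim_null_comparison[OF _ LIMSEQ_inverse_real_of_nat])
    obtain N where N: "max (dist p (fst v)) (dist p' (snd v)) \<le> real N" using real_arch_simple by blast
    show "\<forall>\<^sub>F n in sequentially. norm (dmax (\<rho>1 (g n) x, \<rho>2 (g n) y) v
        - dmax (\<rho>1 (g n) x, \<rho>2 (g n) y) (p, p') - (f v - f (p, p'))) \<le> inverse (real (Suc n))"
      using eventually_ge_at_top[of N]
    proof eventually_elim
      case (elim n)
      then have "v \<in> cball p (real n) \<times> cball p' (real n)" using N by (cases v) auto
      then show ?case using near[of v n] by (simp del: of_nat_Suc)
    qed
  qed
  have "mod_const f \<notin> range (horo_embed dmax)"
    using ideal unfolding f ideal_boundary_def by blast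
  from horofunction_seq_both_factors[OF CAT proper diff lim this]
  show "\<eta> \<in> ideal_boundary_reg p p'"
    using ideal unfolding ideal_boundary_reg_def f by blast
qed

lemma coarsely_equivalent_if_large_limit_set_regular:
  fixes p :: "'a::metric_space" and p' :: "'b::metric_space"
  assumes CAT: "CAT_neg1 TYPE('a)" "CAT_neg1 TYPE('b)"
    and proper: "proper_space TYPE('a)" "proper_space TYPE('b)"
    and act: "isometric_action G \<rho>1" "isometric_action G \<rho>2"
    and reg: "large_limit_set G \<rho>1 \<rho>2 \<subseteq> ideal_boundary_reg p p'"
  shows "coarsely_equivalent G \<rho>1 \<rho>2"
proof -
  let ?U = "{(\<rho>1 g p, \<rho>2 g p') | g. g \<in> carrier G}"
  \<comment> \<open>Being unbounded below, such a limit is no distance function. It therefore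
    represents a point of the large limit set, which is regular by \<open>reg\<close>.\<close>
  have depends: "(\<exists>z z1 z2. f (z, z1) \<noteq> f (z, z2)) \<and> (\<exists>z z1 z2. f (z1, z) \<noteq> f (z2, z))"
    if u: "\<And>n. u n \<in> ?U" and lim: "\<And>y. (\<lambda>n. dmax (u n) y - dmax (u n) (p, p')) \<longlonglongrightarrow> f y"
      and unbounded: "\<And>s. s \<ge> 0 \<Longrightarrow> \<exists>y. f y = - s" for u f
  proof -
    have "mod_const f \<in> large_limit_set G \<rho>1 \<rho>2"
      by (rule horo_compactification_point_in_large_limit_set
          [of _ \<rho>1 p \<rho>2 p' G, OF closure_of_horo_embed_if_pointwise[OF u lim] not_horo_embed_if_unbounded[OF unbounded]])
    then have "mod_const f \<in> ideal_boundary_reg p p'" using reg by blast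
    then show ?thesis
      unfolding ideal_boundary_reg_def using regular_depends_on_both[OF CAT proper] by blast
  qed
  have "\<exists>n. \<forall>g\<in>carrier G. dist p (\<rho>1 g p) - dist p' (\<rho>2 g p') \<le> real n"
  proof (rule ccontr)
    assume "\<not> ?thesis"
    then obtain g where g: "\<And>n :: nat. g n \<in> carrier G"
      and large: "\<And>n. dist p (\<rho>1 (g n) p) - dist p' (\<rho>2 (g n) p') > real n"
      by (metis not_le)
    have "filterlim (\<lambda>n. dist p (\<rho>1 (g n) p) - dist p' (\<rho>2 (g n) p')) at_top sequentially"
      by (rule filterlim_at_top_mono[OF filterlim_real_sequentially])
         (use large less_imp_le in \<open>blast intro: always_eventually\<close>)
    then obtain \<xi> r where \<xi>: "\<xi> \<in> visual_boundary" and "strict_mono (r :: nat \<Rightarrow> nat)" and lim: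
      "\<And>z z'. (\<lambda>n. dmax (\<rho>1 (g (r n)) p, \<rho>2 (g (r n)) p') (z, z')
          - dmax (\<rho>1 (g (r n)) p, \<rho>2 (g (r n)) p') (p, p')) \<longlonglongrightarrow> busemann p \<xi> z"
      by (rule horofunction_seq_first_factor[OF CAT(1) proper(1)]) (rule that)
    have "\<exists>z z1 z2. (\<lambda>y. busemann p \<xi> (fst y)) (z, z1 :: 'b) \<noteq> (\<lambda>y. busemann p \<xi> (fst y)) (z, z2 :: 'b)"
    proof (rule depends[THEN conjunct1])
      show "(\<rho>1 (g (r n)) p, \<rho>2 (g (r n)) p') \<in> ?U" for n using g by blast
      show "(\<lambda>n. dmax (\<rho>1 (g (r n)) p, \<rho>2 (g (r n)) p') y
          - dmax (\<rho>1 (g (r n)) p, \<rho>2 (g (r n)) p') (p, p')) \<longlonglongrightarrow> busemann p \<xi> (fst y)" for y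
        using lim[of "fst y" "snd y"] by simp
      show "\<exists>y :: 'a \<times> 'b. busemann p \<xi> (fst y) = - s" if "s \<ge> 0" for s
        using busemann_attains[OF CAT(1) proper(1) \<xi> that, of p] by (metis fst_conv)
    qed
    then show False by simp
  qed
  then obtain C1 where C1: "\<And>g. g \<in> carrier G \<Longrightarrow> dist p (\<rho>1 g p) - dist p' (\<rho>2 g p') \<le> C1" by blast
  have "\<exists>n. \<forall>g\<in>carrier G. dist p' (\<rho>2 g p') - dist p (\<rho>1 g p) \<le> real n"
  proof (rule ccontr)
    assume "\<not> ?thesis"
    then obtain g where g: "\<And>n :: nat. g n \<in> carrier G"
      and large: "\<And>n. dist p' (\<rho>2 (g n) p') - dist p (\<rho>1 (g n) p) > real n"
      by (metis not_le)
    have "filterlim (\<lambda>n. dist p' (\<rho>2 (g n) p') - dist p (\<rho>1 (g n) p)) at_top sequentially"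
      by (rule filterlim_at_top_mono[OF filterlim_real_sequentially])
         (use large less_imp_le in \<open>blast intro: always_eventually\<close>)
    then obtain \<xi> r where \<xi>: "\<xi> \<in> visual_boundary" and "strict_mono (r :: nat \<Rightarrow> nat)" and lim:
      "\<And>z z'. (\<lambda>n. dmax (\<rho>2 (g (r n)) p', \<rho>1 (g (r n)) p) (z, z')
          - dmax (\<rho>2 (g (r n)) p', \<rho>1 (g (r n)) p) (p', p)) \<longlonglongrightarrow> busemann p' \<xi> z"
      by (rule horofunction_seq_first_factor[OF CAT(2) proper(2)]) (rule that)
    have "\<exists>z z1 z2. (\<lambda>y. busemann p' \<xi> (snd y)) (z1 :: 'a, z) \<noteq> (\<lambda>y. busemann p' \<xi> (snd y)) (z2 :: 'a, z)"
    proof (rule depends[THEN conjunct2])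
      show "(\<rho>1 (g (r n)) p, \<rho>2 (g (r n)) p') \<in> ?U" for n using g by blast
      show "(\<lambda>n. dmax (\<rho>1 (g (r n)) p, \<rho>2 (g (r n)) p') y
          - dmax (\<rho>1 (g (r n)) p, \<rho>2 (g (r n)) p') (p, p')) \<longlonglongrightarrow> busemann p' \<xi> (snd y)" for y
        unfolding dmax_swap[of "(\<rho>1 _ p, _)"] using lim[of "snd y" "fst y"] by (simp add: prod.swap_def)
      show "\<exists>y :: 'a \<times> 'b. busemann p' \<xi> (snd y) = - s" if "s \<ge> 0" for s
        using busemann_attains[OF CAT(2) proper(2) \<xi> that, of p'] by (metis snd_conv)
    qed
    then show False by simp
  qed
  then obtain C2 where C2: "\<And>g. g \<in> carrier G \<Longrightarrow> dist p' (\<rho>2 g p') - dist p (\<rho>1 g p) \<le> C2" by blast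
  have "\<bar>dist p (\<rho>1 g p) - dist p' (\<rho>2 g p')\<bar> \<le> max C1 C2" if "g \<in> carrier G" for g
    using C1[OF that] C2[OF that] by linarith
  then show ?thesis unfolding coarsely_equivalent_iff[OF act, of p p'] by blast
qed

section \<open>Translation lengths and coarse equivalence\<close>

lemma translation_length_eq_if_coarsely_equivalent:
  fixes \<rho>1 :: "'g \<Rightarrow> 'a::metric_space \<Rightarrow> 'a" and \<rho>2 :: "'g \<Rightarrow> 'b::metric_space \<Rightarrow> 'b"
  assumes act: "isometric_action G \<rho>1" "isometric_action G \<rho>2"
    and coarse: "coarsely_equivalent G \<rho>1 \<rho>2" and g: "g \<in> carrier G"
  shows "translation_length (\<rho>1 g) = translation_length (\<rho>2 g)"
proof -
  interpret A: isometric_action G \<rho>1 by fact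
  interpret B: isometric_action G \<rho>2 by fact
  fix x :: 'a and y :: 'b
  obtain C where C: "\<And>g. g \<in> carrier G \<Longrightarrow> \<bar>dist x (\<rho>1 g x) - dist y (\<rho>2 g y)\<bar> \<le> C"
    using coarse unfolding coarsely_equivalent_iff[OF act, of x y] by blast
  have "(\<lambda>n. dist x (\<rho>1 (g [^]\<^bsub>G\<^esub> n) x) / real n - dist y (\<rho>2 (g [^]\<^bsub>G\<^esub> n) y) / real n) \<longlonglongrightarrow> 0"
  proof (rule Lim_null_comparison)
    show "(\<lambda>n. C / real n) \<longlonglongrightarrow> 0" by (rule lim_const_over_n)
    show "\<forall>\<^sub>F n in sequentially. norm (dist x (\<rho>1 (g [^]\<^bsub>G\<^esub> n) x) / real n
        - dist y (\<rho>2 (g [^]\<^bsub>G\<^esub> n) y) / real n) \<le> C / real n"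
      using C g by (simp add: diff_divide_distrib[symmetric] divide_right_mono)
  qed
  moreover have "(\<lambda>n. dist x (\<rho>1 (g [^]\<^bsub>G\<^esub> n) x) / real n - dist y (\<rho>2 (g [^]\<^bsub>G\<^esub> n) y) / real n)
      \<longlonglongrightarrow> translation_length (\<rho>1 g) - translation_length (\<rho>2 g)"
    by (intro tendsto_diff A.stable_length B.stable_length g)
  ultimately show ?thesis using LIMSEQ_unique by fastforce
qed

lemma coarsely_equivalent_if_translation_length_eq:
  fixes \<rho>1 :: "'g \<Rightarrow> 'a::metric_space \<Rightarrow> 'a" and \<rho>2 :: "'g \<Rightarrow> 'b::metric_space \<Rightarrow> 'b"
  assumes CAT: "CAT_neg1 TYPE('a)" "CAT_neg1 TYPE('b)"
    and proper: "proper_space TYPE('a)" "proper_space TYPE('b)"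
    and act: "isometric_action G \<rho>1" "isometric_action G \<rho>2"
    and qc: "quasi_convex_rep G \<rho>1" "quasi_convex_rep G \<rho>2"
    and inf: "infinite (carrier G)"
    and \<tau>: "\<And>g. g \<in> carrier G \<Longrightarrow> translation_length (\<rho>1 g) = translation_length (\<rho>2 g)"
  shows "coarsely_equivalent G \<rho>1 \<rho>2"
proof -
  interpret A: isometric_action G \<rho>1 by fact
  interpret B: isometric_action G \<rho>2 by fact
  fix x :: 'a and y :: 'b
  obtain \<epsilon>1 where "hyperbolic_length G (\<lambda>g. dist x (\<rho>1 g x)) (2 * ln 2) \<epsilon>1"
    using A.hyperbolic_length[OF CAT(1) proper(1) qc(1) inf] by metis
  then interpret HA: hyperbolic_length G "\<lambda>g. dist x (\<rho>1 g x)" "2 * ln 2" \<epsilon>1 .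
  obtain \<epsilon>2 where "hyperbolic_length G (\<lambda>g. dist y (\<rho>2 g y)) (2 * ln 2) \<epsilon>2"
    using B.hyperbolic_length[OF CAT(2) proper(2) qc(2) inf] by metis
  then interpret HB: hyperbolic_length G "\<lambda>g. dist y (\<rho>2 g y)" "2 * ln 2" \<epsilon>2 .
  obtain C1 where C1: "\<And>g. g \<in> carrier G \<Longrightarrow> dist x (\<rho>1 g x) \<le> dist y (\<rho>2 g y) + C1"
    using HA.len_le_if_stable_length_le[of "\<lambda>g. dist y (\<rho>2 g y)" "\<lambda>g. translation_length (\<rho>1 g)"]
      B.dist_act_mult_le A.stable_length(1) B.stable_length(2) \<tau> by force
  obtain C2 where C2: "\<And>g. g \<in> carrier G \<Longrightarrow> dist y (\<rho>2 g y) \<le> dist x (\<rho>1 g x) + C2"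
    using HB.len_le_if_stable_length_le[of "\<lambda>g. dist x (\<rho>1 g x)" "\<lambda>g. translation_length (\<rho>2 g)"]
      A.dist_act_mult_le B.stable_length(1) A.stable_length(2) \<tau> by force
  have "\<bar>dist x (\<rho>1 g x) - dist y (\<rho>2 g y)\<bar> \<le> max C1 C2" if "g \<in> carrier G" for g
    using C1[OF that] C2[OF that] by linarith
  then show ?thesis unfolding coarsely_equivalent_iff[OF act, of x y] by blast
qed

theorem proposition1p2:
  fixes \<Gamma> :: "('g, 'm) monoid_scheme"
    and \<rho>\<^sub>1 :: "'g \<Rightarrow> 'a::metric_space \<Rightarrow> 'a"
    and \<rho>\<^sub>2 :: "'g \<Rightarrow> 'b::metric_space \<Rightarrow> 'b"
    and p :: 'a and p' :: 'b
  assumes "proper_space TYPE('a)" and "CAT_neg1 TYPE('a)"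
    and "proper_space TYPE('b)" and "CAT_neg1 TYPE('b)"
    and "hyperbolic_group \<Gamma>" and "infinite (carrier \<Gamma>)"
    and "quasi_convex_rep \<Gamma> \<rho>\<^sub>1" and "quasi_convex_rep \<Gamma> \<rho>\<^sub>2"
  shows "(large_limit_set \<Gamma> \<rho>\<^sub>1 \<rho>\<^sub>2 \<subseteq> ideal_boundary_reg p p' \<longleftrightarrow>
            coarsely_equivalent \<Gamma> \<rho>\<^sub>1 \<rho>\<^sub>2) \<and>
         (coarsely_equivalent \<Gamma> \<rho>\<^sub>1 \<rho>\<^sub>2 \<longleftrightarrow>
            (\<forall>g\<in>carrier \<Gamma>. translation_length (\<rho>\<^sub>1 g) = translation_length (\<rho>\<^sub>2 g)))"
proof -
  have "group \<Gamma>" using assms(5) by (simp add: hyperbolic_group_def)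
  then have act: "isometric_action \<Gamma> \<rho>\<^sub>1" "isometric_action \<Gamma> \<rho>\<^sub>2"
    using assms(7,8)
    by (simp_all add: isometric_action_def isometric_action_axioms_def quasi_convex_rep_def)
  note CAT = assms(2,4) and proper = assms(1,3)
  show ?thesis
    using large_limit_set_regular_if_coarsely_equivalent[OF CAT proper act]
      coarsely_equivalent_if_large_limit_set_regular[OF CAT proper act]
      translation_length_eq_if_coarsely_equivalent[OF act]
      coarsely_equivalent_if_translation_length_eq[OF CAT proper act assms(7,8,6)]
    by blast
qed

end
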